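(* Let $a,b$ be positive integers and $n=ab$. Every sparse configuration of $n$ unlabeled tokens can be transformed by a finite sequence of pushes into an $a\times b$ box if and only if $a\leq 2$ or $b\leq 2$ or $a=b=3$.
   Context: Tokens occupy distinct cells of the square lattice $\mathbb{Z}^2$; a configuration is the finite set of occupied ("full") cells, and configurations are identified up to translation. The bounding box is the smallest axis-parallel rectangle of cells containing all tokens. A push in direction "left" is the following operation: translate so that the lower-left corner of the bounding box is $(0,0)$; then for the columns $i=1,2,3,\dots$ in increasing order, and for every row $j$, if cell $(i,j)$ is full and $(i-1,j)$ is empty, move the token from $(i,j)$ to $(i-1,j)$. (Thus, in each row, every maximal run of consecutive tokens not containing a token in the leftmost column of the bounding box moves one unit to the left; up to translation this is the same as sweeping a vertical line in from the left that displaces the leftmost tokens, and whatever they collide with, by one unit.) Pushes in the directions right, up and down are defined symmetrically. A configuration is sparse if no row and no column contains more than one token. An $a\times b$ box is a configuration whose tokens occupy exactly all cells of a rectangle with $a$ columns and $b$ rows. *)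

theory Defs
  imports Main
begin

text \<open>
  Cells are pairs (column, row). Configurations are finite sets of cells, considered up to
  translation; we work with representatives. This is harmless: a push first moves its argument
  to the origin, so its result depends only on the translation class, and the predicates
  \<open>sparse\<close> and \<open>is_box\<close> are translation invariant.
\<close>

type_synonym cell = "int \<times> int"

definition to_origin :: "cell set \<Rightarrow> cell set" where
  "to_origin S = (\<lambda>(x, y). (x - Min (fst ` S), y - Min (snd ` S))) ` S"

definition shift_column :: "int \<Rightarrow> cell set \<Rightarrow> cell set" where
  "shift_column i S =
     (\<lambda>(x, y). if x = i \<and> (i - 1, y) \<notin> S then (i - 1, y) else (x, y)) ` S"

text \<open>
  The columns are processed one after the other, each step acting on the result of the previous
  ones. Columns to the right of the last occupied one are empty, so stopping there loses nothing.
\<close>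

definition push_left :: "cell set \<Rightarrow> cell set" where
  "push_left S = (let N = to_origin S in fold shift_column [1..Max (fst ` N)] N)"

definition mirror :: "cell \<Rightarrow> cell" where
  "mirror = (\<lambda>(x, y). (- x, y))"

datatype direction = Leftward | Rightward | Upward | Downward

fun push :: "direction \<Rightarrow> cell set \<Rightarrow> cell set" where
  "push Leftward S = push_left S"
| "push Rightward S = mirror ` push_left (mirror ` S)"
| "push Downward S = prod.swap ` push_left (prod.swap ` S)"
| "push Upward S = prod.swap ` mirror ` push_left (mirror ` prod.swap ` S)"

definition sparse :: "cell set \<Rightarrow> bool" where
  "sparse S \<longleftrightarrow>
     (\<forall>p\<in>S. \<forall>q\<in>S. fst p = fst q \<longrightarrow> p = q) \<and>
     (\<forall>p\<in>S. \<forall>q\<in>S. snd p = snd q \<longrightarrow> p = q)"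

definition is_box :: "nat \<Rightarrow> nat \<Rightarrow> cell set \<Rightarrow> bool" where
  "is_box a b S \<longleftrightarrow> (\<exists>x y. S = {x..<x + int a} \<times> {y..<y + int b})"

end

theory Submission
  imports Defs
begin

text \<open>
  In every row a push to the left deletes the first empty cell of the bounding box. Hence no push
  lowers the maximal number of tokens in a column or in a row, and a configuration with more than
  \<open>b\<close> tokens in a column or more than \<open>a\<close> in a row never becomes an \<open>a \<times> b\<close> box.

  Suppose that \<open>a, b \<ge> 3\<close> and not \<open>a = b = 3\<close>, and arrange \<open>n = a b\<close> tokens along the sides of a
  diamond in an \<open>n \<times> n\<close> square. As long as no two tokens collide, pushes just clamp coordinates to a
  shrinking rectangle, and each push moves one more token onto a side of it; so at most
  \<open>b - 1\<close> pushes each from the left and the right and \<open>a - 1\<close> each from above and below are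
  possible before a column or a row gets too full. A collision needs two tokens in a corner rectangle of
  semiperimeter about \<open>n / 2\<close>, which is out of reach because \<open>(a - 2) (b - 2) \<ge> 2\<close>.

  Conversely, \<open>a\<close> adjacent columns of \<open>b\<close> tokens each can be compressed vertically to a box. For
  \<open>a \<le> 2\<close> such columns arise by clamping. For \<open>a = b = 3\<close> clamp the three lowest and the three
  highest tokens into a row each, then push the leftmost and the rightmost of the other three
  to the side, leaving the middle one in the second of three columns.
\<close>

section \<open>Translates\<close>

definition translate :: "int \<Rightarrow> int \<Rightarrow> cell \<Rightarrow> cell" where
  "translate u v = (\<lambda>(x, y). (x + u, y + v))"

definition same_shape :: "cell set \<Rightarrow> cell set \<Rightarrow> bool" (infix "\<approx>" 50) where
  "S \<approx> T \<longleftrightarrow> (\<exists>u v. S = translate u v ` T)"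

lemma translate_pair [simp]: "translate u v (x, y) = (x + u, y + v)"
  by (simp add: translate_def)

lemma translate_image_0 [simp]: "translate 0 0 ` S = S"
  by (force simp: translate_def)

lemma translate_translate:
  "translate u v ` translate u' v' ` S = translate (u + u') (v + v') ` S"
  by (force simp: translate_def image_image)

lemma same_shape_refl [simp]: "S \<approx> S"
  unfolding same_shape_def by (metis translate_image_0)

lemma same_shape_translate [simp]: "translate u v ` S \<approx> S"
  unfolding same_shape_def by blast

lemma same_shape_sym: "S \<approx> T \<Longrightarrow> T \<approx> S"
  unfolding same_shape_def by (metis translate_translate translate_image_0 add.left_inverse)

lemma same_shape_trans [trans]: "S \<approx> T \<Longrightarrow> T \<approx> U \<Longrightarrow> S \<approx> U"
  unfolding same_shape_def by (metis translate_translate)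

section \<open>Reflections of the grid and their interplay with translations\<close>

lemma mirror_pair [simp]: "mirror (x, y) = (- x, y)"
  by (simp add: mirror_def)

lemma mirror_mirror [simp]: "mirror (mirror p) = p"
  by (cases p) simp

lemma mirror_image_mirror [simp]: "mirror ` mirror ` S = S"
  by (simp add: image_image)

lemma swap_image_swap [simp]: "prod.swap ` prod.swap ` S = S"
  by (simp add: image_image)

lemma mirror_translate: "mirror ` translate u v ` S = translate (- u) v ` mirror ` S"
  by (force simp: image_image)

lemma swap_translate: "prod.swap ` translate u v ` S = translate v u ` prod.swap ` S"
  by (force simp: image_image)

lemma same_shape_mirror: "S \<approx> T \<Longrightarrow> mirror ` S \<approx> mirror ` T"
  unfolding same_shape_def by (metis mirror_translate)

lemma same_shape_swap: "S \<approx> T \<Longrightarrow> prod.swap ` S \<approx> prod.swap ` T"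
  unfolding same_shape_def by (metis swap_translate)

lemma to_origin_eq: "to_origin S = translate (- Min (fst ` S)) (- Min (snd ` S)) ` S"
  by (force simp: to_origin_def translate_def)

lemma Min_image_add:
  fixes f :: "'a \<Rightarrow> int"
  assumes "finite S" and "S \<noteq> {}"
  shows "Min ((\<lambda>p. f p + u) ` S) = Min (f ` S) + u"
proof -
  have "(\<lambda>p. f p + u) ` S = (\<lambda>z. z + u) ` f ` S" by (simp add: image_image)
  moreover have "Min ((\<lambda>z. z + u) ` f ` S) = Min (f ` S) + u"
    using assms by (subst mono_Min_commute [symmetric]) (auto simp: mono_def)
  ultimately show ?thesis by simp
qed

lemma fst_translate: "fst ` translate u v ` S = (\<lambda>p. fst p + u) ` S"
  and snd_translate: "snd ` translate u v ` S = (\<lambda>p. snd p + v) ` S"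
  by (force simp: image_image translate_def)+

lemma to_origin_translate:
  assumes "finite S" and "S \<noteq> {}"
  shows "to_origin (translate u v ` S) = to_origin S"
  using assms
  by (simp add: to_origin_eq fst_translate snd_translate Min_image_add translate_translate)

text \<open>A push starts by normalising its argument, so translates give equal results and not
  merely results of the same shape. Nonemptiness keeps \<open>Min\<close> meaningful.\<close>

lemma push_left_cong: "S \<approx> T \<Longrightarrow> finite T \<Longrightarrow> T \<noteq> {} \<Longrightarrow> push_left S = push_left T"
  unfolding same_shape_def push_left_def using to_origin_translate by metis

lemma push_cong:
  assumes "S \<approx> T" and "finite T" and "T \<noteq> {}"
  shows "push d S = push d T"
proof (cases d)
  case Leftward
  then show ?thesis using assms by (simp add: push_left_cong)
next
  case Rightward
  then show ?thesis using push_left_cong [OF same_shape_mirror [OF assms(1)]] assms by simp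
next
  case Upward
  then show ?thesis
    using push_left_cong [OF same_shape_mirror [OF same_shape_swap [OF assms(1)]]] assms by simp
next
  case Downward
  then show ?thesis using push_left_cong [OF same_shape_swap [OF assms(1)]] assms by simp
qed

section \<open>A closed form for pushes\<close>

text \<open>Measured from the left wall, this is the column in which the token comes to rest after
  enough pushes to the left.\<close>

definition rank :: "cell set \<Rightarrow> cell \<Rightarrow> int" where
  "rank S p = int (card {z. z < fst p \<and> (z, snd p) \<in> S})"

text \<open>The effect of \<open>k\<close> consecutive pushes to the left, without the translation to the origin:
  a token stops once all cells to its left in its row are filled.\<close>

definition slide :: "int \<Rightarrow> cell set \<Rightarrow> cell set" where
  "slide k S = (\<lambda>(x, y). (max (x - k) (Min (fst ` S) + rank S (x, y)), y)) ` S"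

lemma finite_row: "finite S \<Longrightarrow> finite {z. (z, y) \<in> S}"
  by (rule finite_subset [of _ "fst ` S"]) force+

lemma Min_fst_le: "finite S \<Longrightarrow> (x, y) \<in> S \<Longrightarrow> Min (fst ` S) \<le> x"
  by (rule Min_le) force+

text \<open>The full cells to the left of the token form a subset of the interval from the wall up
  to \<open>x\<close>; this subset is proper exactly when there is a gap, so cardinalities decide.
  The condition for a token to move thus becomes an inequality.\<close>

lemma gap_iff:
  assumes "finite S" and "(x, y) \<in> S"
  shows "(\<exists>z. Min (fst ` S) \<le> z \<and> z < x \<and> (z, y) \<notin> S) \<longleftrightarrow> x > Min (fst ` S) + rank S (x, y)"
    and "Min (fst ` S) + rank S (x, y) \<le> x"
proof -
  let ?m = "Min (fst ` S)"
  let ?A = "{z. z < x \<and> (z, y) \<in> S}"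
  have m: "?m \<le> x" using assms by (rule Min_fst_le)
  have sub: "?A \<subseteq> {?m..<x}" using assms(1) by (auto intro: Min_fst_le)
  have "card ?A \<le> card {?m..<x}" using sub by (intro card_mono) auto
  then show "?m + rank S (x, y) \<le> x" using m by (simp add: rank_def)
  show "(\<exists>z. ?m \<le> z \<and> z < x \<and> (z, y) \<notin> S) \<longleftrightarrow> x > ?m + rank S (x, y)"
  proof
    assume "\<exists>z. ?m \<le> z \<and> z < x \<and> (z, y) \<notin> S"
    then have "?A \<subset> {?m..<x}" using sub by auto
    then have "card ?A < card {?m..<x}" by (intro psubset_card_mono) auto
    then show "x > ?m + rank S (x, y)" using m by (simp add: rank_def)
  next
    assume *: "x > ?m + rank S (x, y)"
    show "\<exists>z. ?m \<le> z \<and> z < x \<and> (z, y) \<notin> S"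
    proof (rule ccontr)
      assume "\<not> ?thesis"
      then have "?A = {?m..<x}" using sub by auto
      then show False using * m by (simp add: rank_def)
    qed
  qed
qed

lemma rank_mono:
  assumes "finite S" and "(x, y) \<in> S" and "x < x'"
  shows "rank S (x, y) + 1 \<le> rank S (x', y)"
proof -
  have "{z. z < x \<and> (z, y) \<in> S} \<subset> {z. z < x' \<and> (z, y) \<in> S}" using assms by auto
  then have "card {z. z < x \<and> (z, y) \<in> S} < card {z. z < x' \<and> (z, y) \<in> S}"
    using finite_row [OF assms(1), of y] by (intro psubset_card_mono) (auto intro: rev_finite_subset)
  then show ?thesis by (simp add: rank_def)
qed

lemma slide_0 [simp]:
  assumes "finite S"
  shows "slide 0 S = S"
proof -
  have "slide 0 S = (\<lambda>p. p) ` S"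
    unfolding slide_def by (rule image_cong) (auto simp: gap_iff(2) [OF assms] max_absorb1)
  then show ?thesis by simp
qed

lemma finite_slide [simp]: "finite S \<Longrightarrow> finite (slide k S)"
  by (simp add: slide_def)

lemma slide_empty_iff [simp]: "slide k S = {} \<longleftrightarrow> S = {}"
  by (simp add: slide_def)

text \<open>Tokens in the leftmost column have rank 0 and stay put. Consecutive slides therefore
  refer to the same wall.\<close>

lemma Min_fst_slide:
  assumes "finite S" and "S \<noteq> {}" and "0 \<le> k"
  shows "Min (fst ` slide k S) = Min (fst ` S)"
proof (rule Min_eqI)
  show "finite (fst ` slide k S)" using assms by simp
  fix z assume "z \<in> fst ` slide k S"
  then obtain x y where "(x, y) \<in> S" "z = max (x - k) (Min (fst ` S) + rank S (x, y))"
    by (auto simp: slide_def)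
  then show "Min (fst ` S) \<le> z" by (simp add: rank_def)
next
  have "Min (fst ` S) \<in> fst ` S" using assms by (intro Min_in) auto
  then obtain y where y: "(Min (fst ` S), y) \<in> S" by force
  then have "rank S (Min (fst ` S), y) = 0"
    using gap_iff(2) [OF assms(1) y] by (simp add: rank_def)
  then show "Min (fst ` S) \<in> fst ` slide k S"
    using y assms(3) unfolding slide_def by (force simp: image_image)
qed

lemma slide_strict_mono:
  assumes "finite S" and "(x, y) \<in> S" and "x < x'"
  shows "max (x - k) (m + rank S (x, y)) < max (x' - k) (m + rank S (x', y))"
  using rank_mono [OF assms] assms(3) by linarith

text \<open>Within a row a slide is strictly increasing, so tokens keep their order and hence the
  number of tokens on their left.\<close>

lemma rank_slide:
  assumes "finite S" and "(x, y) \<in> S"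
  shows "rank (slide k S) (max (x - k) (Min (fst ` S) + rank S (x, y)), y) = rank S (x, y)"
proof -
  let ?f = "\<lambda>x. max (x - k) (Min (fst ` S) + rank S (x, y))"
  have mono: "?f x < ?f x' \<longleftrightarrow> x < x'" if "(x, y) \<in> S" "(x', y) \<in> S" for x x'
    using slide_strict_mono [OF assms(1) that(1), of x' k "Min (fst ` S)"]
      slide_strict_mono [OF assms(1) that(2), of x k "Min (fst ` S)"] by (metis less_asym linorder_less_linear)
  have "{z. z < ?f x \<and> (z, y) \<in> slide k S} = ?f ` {z. z < x \<and> (z, y) \<in> S}"
    using mono assms(2) by (auto simp: slide_def)
  moreover have "inj_on ?f {z. z < x \<and> (z, y) \<in> S}"
    by (rule inj_onI) (metis (no_types, lifting) less_irrefl linorder_less_linear mem_Collect_eq mono)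
  ultimately show ?thesis by (simp add: rank_def card_image)
qed

text \<open>Wall and ranks survive the first slide, so the two maxima are taken against the same
  resting column and collapse into one; \<open>0 \<le> j\<close> makes this work.\<close>

lemma slide_slide:
  assumes "finite S" and "0 \<le> k" and "0 \<le> j"
  shows "slide j (slide k S) = slide (k + j) S"
proof (cases "S = {}")
  case False
  let ?m = "Min (fst ` S)"
  have "slide j (slide k S) =
      (\<lambda>(x, y). (max (x - j) (?m + rank (slide k S) (x, y)), y)) ` slide k S"
    by (simp add: slide_def [of j] Min_fst_slide [OF assms(1) False assms(2)])
  also have "\<dots> = (\<lambda>(x, y). (max (max (x - k) (?m + rank S (x, y)) - j) (?m + rank S (x, y)), y)) ` S"
    unfolding slide_def [of k] image_image
    by (rule image_cong) (auto simp: rank_slide [OF assms(1), unfolded slide_def])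
  also have "\<dots> = slide (k + j) S"
    unfolding slide_def by (rule image_cong) (use assms(3) in \<open>auto simp: max_def\<close>)
  finally show ?thesis .
qed (simp add: slide_def)

text \<open>Although the columns are processed one after the other, whether a token moves can be
  read off the initial configuration \<open>N\<close>: a gap to its left in \<open>N\<close> has
  travelled next to the token by the time its column is processed.\<close>

lemma fold_shift_column:
  assumes "\<And>x y. (x, y) \<in> N \<Longrightarrow> 0 \<le> x"
  shows "fold shift_column [1..int k] N =
    (\<lambda>(x, y). (if x \<le> int k \<and> (\<exists>z. 0 \<le> z \<and> z < x \<and> (z, y) \<notin> N) then x - 1 else x, y)) ` N"
proof (induction k)
  case 0
  have "(if x \<le> 0 \<and> (\<exists>z. 0 \<le> z \<and> z < x \<and> (z, y) \<notin> N) then x - 1 else x) = x" for x y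
    by auto
  then show ?case by simp
next
  case (Suc k)
  let ?g = "\<lambda>k (x, y). (if x \<le> int k \<and> (\<exists>z. 0 \<le> z \<and> z < x \<and> (z, y) \<notin> N) then x - 1 else x, y)"
  let ?A = "?g k ` N"
  have upto: "[1..int (Suc k)] = [1..int k] @ [int (Suc k)]"
    by (simp add: upto_rec2)
  \<comment> \<open>Once columns 1 to \<open>k\<close> are processed, column \<open>k\<close> of a
    row is full only if its token did not move, that is, if the row of \<open>N\<close> is full up
    to and including column \<open>k\<close>. No token of column \<open>k + 1\<close> can have
    arrived yet.\<close>
  have mem: "(int k, y) \<in> ?A \<longleftrightarrow> (\<forall>z. 0 \<le> z \<and> z < int (Suc k) \<longrightarrow> (z, y) \<in> N)" for y
  proof
    assume "(int k, y) \<in> ?A"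
    then have "(int k, y) \<in> N \<and> \<not> (\<exists>z. 0 \<le> z \<and> z < int k \<and> (z, y) \<notin> N)"
      by (auto split: if_splits)
    then show "\<forall>z. 0 \<le> z \<and> z < int (Suc k) \<longrightarrow> (z, y) \<in> N"
      by (metis int_ops(4) zless_add1_eq add.commute)
  next
    assume *: "\<forall>z. 0 \<le> z \<and> z < int (Suc k) \<longrightarrow> (z, y) \<in> N"
    then have "(int k, y) \<in> N" by simp
    moreover have "?g k (int k, y) = (int k, y)" using * by auto
    ultimately show "(int k, y) \<in> ?A" by (metis (no_types, lifting) image_eqI)
  qed
  have "shift_column (int (Suc k)) ?A = ?g (Suc k) ` N"
    unfolding shift_column_def image_image
  proof (rule image_cong [OF refl])
    fix p assume "p \<in> N"
    then obtain x y where p: "p = (x, y)" "(x, y) \<in> N" by (cases p) auto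
    consider "x \<le> int k" | "x = int (Suc k)" | "x > int (Suc k)" by linarith
    then show "(case ?g k p of (x, y) \<Rightarrow> if x = int (Suc k) \<and> (int (Suc k) - 1, y) \<notin> ?A
        then (int (Suc k) - 1, y) else (x, y)) = ?g (Suc k) p"
    proof cases
      case 2
      have "(int (Suc k) - 1, y) \<notin> ?A \<longleftrightarrow> (\<exists>z. 0 \<le> z \<and> z < int (Suc k) \<and> (z, y) \<notin> N)"
        using mem [of y] by auto
      moreover have "?g k p = (int (Suc k), y)" using 2 p by simp
      ultimately show ?thesis using 2 p by auto
    qed (use p in auto)
  qed
  moreover have "fold shift_column [1..int (Suc k)] N =
      shift_column (int (Suc k)) (fold shift_column [1..int k] N)"
    unfolding upto fold_append by simp
  ultimately show ?case using Suc.IH by simp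
qed

lemma slide_translate:
  assumes "finite S" and "S \<noteq> {}"
  shows "slide k (translate u v ` S) = translate u v ` slide k S"
proof -
  have "rank (translate u v ` S) (x + u, y + v) = rank S (x, y)" for x y
  proof -
    have "{z. z < x + u \<and> (z, y + v) \<in> translate u v ` S} = (\<lambda>z. z + u) ` {z. z < x \<and> (z, y) \<in> S}"
      by (force simp: image_iff translate_def)
    then show ?thesis by (simp add: rank_def card_image)
  qed
  moreover have M: "Min (fst ` translate u v ` S) = Min (fst ` S) + u"
    by (simp only: fst_translate Min_image_add [OF assms])
  ultimately have "slide k (translate u v ` S) =
      (\<lambda>(x, y). (max (x + u - k) (Min (fst ` S) + u + rank S (x, y)), y + v)) ` S"
    unfolding slide_def M unfolding image_image by (intro image_cong) auto
  also have "\<dots> = translate u v ` slide k S"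
    unfolding slide_def image_image by (intro image_cong) (auto simp: max_def)
  finally show ?thesis .
qed

text \<open>After normalisation the wall is column 0, and \<open>gap_iff\<close> says that a token
  has a gap to its left iff its column exceeds its rank. These are the tokens that the maximum in
  \<open>slide\<close> with \<open>k = 1\<close> moves by one.\<close>

lemma push_left_slide:
  assumes "finite S" and "S \<noteq> {}"
  shows "push_left S \<approx> slide 1 S"
proof -
  define N where "N = to_origin S"
  define m where "m = nat (Max (fst ` N))"
  have NS: "N \<approx> S" by (simp add: N_def to_origin_eq)
  have fin: "finite N" "N \<noteq> {}" using assms by (simp_all add: N_def to_origin_eq)
  have Min0: "Min (fst ` N) = 0"
    using Min_image_add [OF assms, of fst "- Min (fst ` S)"]
    by (simp add: N_def to_origin_eq fst_translate)
  then have nonneg: "0 \<le> x" if "(x, y) \<in> N" for x y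
    using Min_fst_le [OF fin(1) that] by simp
  have ub: "x \<le> int m" if "(x, y) \<in> N" for x y
  proof -
    have "x \<le> Max (fst ` N)" using fin that by (intro Max_ge) force+
    then show ?thesis by (simp add: m_def)
  qed
  have "Max (fst ` N) = int m"
  proof -
    have "Max (fst ` N) \<in> fst ` N" using fin by (intro Max_in) auto
    then show ?thesis using nonneg by (force simp: m_def)
  qed
  then have "push_left S = fold shift_column [1..int m] N"
    by (simp add: push_left_def N_def)
  also have "\<dots> = (\<lambda>(x, y). (if x \<le> int m \<and> (\<exists>z. 0 \<le> z \<and> z < x \<and> (z, y) \<notin> N) then x - 1 else x, y)) ` N"
    by (rule fold_shift_column) (rule nonneg)
  also have "\<dots> = slide 1 N"
    unfolding slide_def
  proof (rule image_cong [OF refl])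
    fix p assume "p \<in> N"
    then obtain x y where p: "p = (x, y)" "(x, y) \<in> N" by (cases p) auto
    show "(case p of (x, y) \<Rightarrow> (if x \<le> int m \<and> (\<exists>z. 0 \<le> z \<and> z < x \<and> (z, y) \<notin> N) then x - 1 else x, y)) =
      (case p of (x, y) \<Rightarrow> (max (x - 1) (Min (fst ` N) + rank N (x, y)), y))"
      using gap_iff [OF fin(1) p(2)] ub [OF p(2)] unfolding Min0 p(1) by auto
  qed
  finally have "push_left S = slide 1 N" .
  moreover have "slide 1 N = translate (- Min (fst ` S)) (- Min (snd ` S)) ` slide 1 S"
    using assms by (simp add: N_def to_origin_eq slide_translate)
  ultimately show ?thesis by simp
qed


section \<open>Reachability\<close>

text \<open>The target is met up to translation only, which leaves the coordinates of intermediate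
  configurations free.\<close>

definition reaches :: "cell set \<Rightarrow> cell set \<Rightarrow> bool" where
  "reaches S T \<longleftrightarrow> (\<exists>ds. fold push ds S \<approx> T)"

lemma finite_push_left [simp]: "finite S \<Longrightarrow> finite (push_left S)"
  and push_left_empty_iff [simp]: "finite S \<Longrightarrow> push_left S = {} \<longleftrightarrow> S = {}"
proof -
  have *: "fold shift_column xs S = {} \<longleftrightarrow> S = {}" "finite S \<Longrightarrow> finite (fold shift_column xs S)"
    for xs S
    by (induction xs arbitrary: S) (simp_all add: shift_column_def)
  show "finite S \<Longrightarrow> finite (push_left S)" "finite S \<Longrightarrow> push_left S = {} \<longleftrightarrow> S = {}"
    by (simp_all add: push_left_def Let_def * to_origin_eq)
qed

lemma fold_push_cong:
  assumes "S \<approx> T" and "finite T" and "T \<noteq> {}"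
  shows "fold push ds S \<approx> fold push ds T"
  using assms by (cases ds) (simp_all add: push_cong [OF assms])

lemma reaches_same_shape: "S \<approx> T \<Longrightarrow> reaches S T"
  unfolding reaches_def by (rule exI [of _ "[]"]) simp

lemma reaches_refl [simp]: "reaches S S"
  by (simp add: reaches_same_shape)

lemma reaches_trans [trans]:
  assumes "reaches S T" and "reaches T U" and "finite T" and "T \<noteq> {}"
  shows "reaches S U"
proof -
  obtain ds es where ds: "fold push ds S \<approx> T" and es: "fold push es T \<approx> U"
    using assms(1,2) by (auto simp: reaches_def)
  have "fold push (ds @ es) S \<approx> fold push es T"
    using fold_push_cong [OF ds assms(3,4)] by simp
  then show ?thesis using es same_shape_trans unfolding reaches_def by blast
qed

lemma reaches_swap:
  assumes "reaches S T"
  shows "reaches (prod.swap ` S) (prod.swap ` T)"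
proof -
  \<comment> \<open>Reflection in the diagonal permutes the four directions in this way, so a
    sequence of pushes can be reflected step by step.\<close>
  define flip where "flip d = (case d of Leftward \<Rightarrow> Downward | Downward \<Rightarrow> Leftward
    | Rightward \<Rightarrow> Upward | Upward \<Rightarrow> Rightward)" for d
  have "push (flip d) (prod.swap ` S) = prod.swap ` push d S" for d S
    by (cases d) (simp_all add: flip_def)
  then have "fold push (map flip ds) (prod.swap ` S) = prod.swap ` fold push ds S" for ds
    by (induction ds arbitrary: S) simp_all
  then show ?thesis
    using assms same_shape_swap unfolding reaches_def by metis
qed

lemma reaches_slide:
  assumes "finite S" and "S \<noteq> {}"
  shows "reaches S (slide (int k) S)"
    and "reaches S (mirror ` slide (int k) (mirror ` S))"
    and "reaches S (prod.swap ` slide (int k) (prod.swap ` S))"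
    and "reaches S (prod.swap ` mirror ` slide (int k) (mirror ` prod.swap ` S))"
proof -
  \<comment> \<open>Every direction is a left push conjugated by a symmetry \<open>f\<close> with
    inverse \<open>g\<close>, so one induction on the number of pushes serves all four.\<close>
  have step: "reaches S (f ` slide (int k) (g ` S))"
    if inv: "\<And>S. f ` g ` S = S" "\<And>S. g ` f ` S = S"
      and push: "\<And>S. push d S = f ` push_left (g ` S)"
      and cong: "\<And>S T. S \<approx> T \<Longrightarrow> f ` S \<approx> f ` T" for d and f g :: "cell \<Rightarrow> cell"
  proof (induction k)
    case 0
    then show ?case using assms by (simp add: inv)
  next
    case (Suc k)
    let ?T = "slide (int k) (g ` S)"
    have T: "finite ?T" "?T \<noteq> {}" using assms by simp_all
    have "push d (f ` ?T) = f ` push_left ?T" by (simp add: push inv)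
    also have "\<dots> \<approx> f ` slide 1 ?T" by (intro cong push_left_slide T)
    also have "slide 1 ?T = slide (int (Suc k)) (g ` S)"
      using assms by (subst slide_slide) (simp_all add: add.commute)
    finally have "reaches (f ` ?T) (f ` slide (int (Suc k)) (g ` S))"
      unfolding reaches_def by (intro exI [of _ "[d]"]) simp
    with Suc show ?case by (rule reaches_trans) (use T in auto)
  qed
  show "reaches S (slide (int k) S)"
    using step [of id id Leftward] by simp
  show "reaches S (mirror ` slide (int k) (mirror ` S))"
    using step [of mirror mirror Rightward] same_shape_mirror by simp
  show "reaches S (prod.swap ` slide (int k) (prod.swap ` S))"
    using step [of prod.swap prod.swap Downward] same_shape_swap by simp
  show "reaches S (prod.swap ` mirror ` slide (int k) (mirror ` prod.swap ` S))"
  proof -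
    have c: "(prod.swap \<circ> mirror) ` T = prod.swap ` mirror ` T"
      "(mirror \<circ> prod.swap) ` T = mirror ` prod.swap ` T" for T
      by (simp_all only: image_comp)
    have "reaches S ((prod.swap \<circ> mirror) ` slide (int k) ((mirror \<circ> prod.swap) ` S))"
      by (rule step [of _ _ Upward])
        (simp_all only: c mirror_image_mirror swap_image_swap push.simps same_shape_mirror same_shape_swap)
    then show ?thesis by (simp only: c)
  qed
qed

section \<open>Clamping\<close>

text \<open>If clamping merges no tokens, those to the left of a given token have distinct clamped
  columns between \<open>k\<close> and its own. This bounds its rank, so it is never held up by
  other tokens and moves as if it were alone.\<close>

lemma slide_clamp:
  assumes "finite S" and "inj_on (\<lambda>(x, y). (max k x, y)) S" and "Min (fst ` S) \<le> k"
  shows "slide (k - Min (fst ` S)) S \<approx> (\<lambda>(x, y). (max k x, y)) ` S"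
proof -
  let ?m = "Min (fst ` S)"
  have rank: "rank S (x, y) \<le> max k x - k" if p: "(x, y) \<in> S" for x y
  proof -
    let ?B = "{z. z < x \<and> (z, y) \<in> S}"
    have inj: "z = z'" if "(z, y) \<in> S" "(z', y) \<in> S" "max k z = max k z'" for z z'
      using inj_onD [OF assms(2), of "(z, y)" "(z', y)"] that by simp
    show ?thesis
    proof (cases "x \<le> k")
      case True
      have "\<not> (z < x \<and> (z, y) \<in> S)" for z
        using inj [OF _ p, of z] True by (auto simp: max_absorb1)
      then have "?B = {}" by blast
      then show ?thesis using True by (simp only: rank_def fst_conv snd_conv card.empty)
    next
      case False
      have "card ?B = card (max k ` ?B)"
        using inj by (intro card_image [symmetric] inj_onI) auto
      also have "\<dots> \<le> card {k..<x}" using False by (intro card_mono) auto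
      finally show ?thesis using False by (simp add: rank_def)
    qed
  qed
  have "slide (k - ?m) S = translate (?m - k) 0 ` (\<lambda>(x, y). (max k x, y)) ` S"
    unfolding slide_def image_image
  proof (intro image_cong [OF refl], clarify)
    fix x y assume "(x, y) \<in> S"
    moreover have "0 \<le> rank S (x, y)" by (simp add: rank_def)
    ultimately have "max (x - (k - ?m)) (?m + rank S (x, y)) = max k x + (?m - k)"
      using rank [of x y] by (auto simp: max_def split: if_splits)
    then show "(max (x - (k - ?m)) (?m + rank S (x, y)), y) = translate (?m - k) 0 (max k x, y)"
      by simp
  qed
  then show ?thesis by simp
qed

lemma clamp_same_shape:
  assumes "finite S" and "inj_on (\<lambda>(x, y). (max k x, y)) S"
  shows "\<exists>j. slide (int j) S \<approx> (\<lambda>(x, y). (max k x, y)) ` S"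
proof (cases "Min (fst ` S) \<le> k")
  case True
  then show ?thesis
    using slide_clamp [OF assms True] by (intro exI [of _ "nat (k - Min (fst ` S))"]) simp
next
  case False
  then have "(\<lambda>(x, y). (max k x, y)) ` S = (\<lambda>p. p) ` S"
    using Min_fst_le [OF assms(1)] by (intro image_cong) (force simp: max_def)+
  then show ?thesis using assms(1) by (intro exI [of _ 0]) simp
qed

lemma reaches_clamp:
  assumes "finite S" and "S \<noteq> {}"
  shows "inj_on (\<lambda>(x, y). (max k x, y)) S \<Longrightarrow> reaches S ((\<lambda>(x, y). (max k x, y)) ` S)"
    and "inj_on (\<lambda>(x, y). (min k x, y)) S \<Longrightarrow> reaches S ((\<lambda>(x, y). (min k x, y)) ` S)"
    and "inj_on (\<lambda>(x, y). (x, max k y)) S \<Longrightarrow> reaches S ((\<lambda>(x, y). (x, max k y)) ` S)"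
    and "inj_on (\<lambda>(x, y). (x, min k y)) S \<Longrightarrow> reaches S ((\<lambda>(x, y). (x, min k y)) ` S)"
proof -
  \<comment> \<open>\<open>g\<close> turns the wall in question into a left wall and
    \<open>f\<close> undoes this; \<open>h\<close> is the clamp in the original coordinates.\<close>
  have *: "reaches S (h ` S)"
    if inj: "inj_on h S" and gh: "\<And>p. g (h p) = (case g p of (x, y) \<Rightarrow> (max k x, y))"
      and fg: "\<And>p. f (g p) = p"
      and cong: "\<And>S T. S \<approx> T \<Longrightarrow> f ` S \<approx> f ` T"
      and slide: "\<And>j. reaches S (f ` slide (int j) (g ` S))"
    for h f g and k :: int
  proof -
    let ?c = "\<lambda>(x, y). (max k x, y)"
    have "inj_on ?c (g ` S)"
    proof (rule inj_onI)
      fix p q assume "p \<in> g ` S" "q \<in> g ` S" "?c p = ?c q"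
      then show "p = q" using gh fg inj by (metis (no_types, lifting) imageE inj_onD)
    qed
    then obtain j where "slide (int j) (g ` S) \<approx> ?c ` g ` S"
      using clamp_same_shape assms(1) by blast
    then have "f ` slide (int j) (g ` S) \<approx> f ` ?c ` g ` S" by (rule cong)
    also have "f ` ?c ` g ` S = h ` S"
      unfolding image_image gh [symmetric] fg ..
    finally have *: "f ` slide (int j) (g ` S) \<approx> h ` S" .
    obtain ds where "fold push ds S \<approx> f ` slide (int j) (g ` S)"
      using slide [of j] unfolding reaches_def by blast
    from same_shape_trans [OF this *] show ?thesis unfolding reaches_def by blast
  qed
  show "inj_on (\<lambda>(x, y). (max k x, y)) S \<Longrightarrow> reaches S ((\<lambda>(x, y). (max k x, y)) ` S)"
    using reaches_slide(1) [OF assms] by (intro * [of _ id k id]) auto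
  show "inj_on (\<lambda>(x, y). (min k x, y)) S \<Longrightarrow> reaches S ((\<lambda>(x, y). (min k x, y)) ` S)"
    using reaches_slide(2) [OF assms] same_shape_mirror
    by (intro * [of _ mirror "- k" mirror]) (auto simp: max_def min_def split: prod.splits)
  show "inj_on (\<lambda>(x, y). (x, max k y)) S \<Longrightarrow> reaches S ((\<lambda>(x, y). (x, max k y)) ` S)"
    using reaches_slide(3) [OF assms] same_shape_swap
    by (intro * [of _ prod.swap k prod.swap]) auto
  show "inj_on (\<lambda>(x, y). (x, min k y)) S \<Longrightarrow> reaches S ((\<lambda>(x, y). (x, min k y)) ` S)"
    using reaches_slide(4) [OF assms] same_shape_swap same_shape_mirror
    by (intro * [of _ "\<lambda>p. mirror (prod.swap p)" "- k" "\<lambda>p. prod.swap (mirror p)"])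
      (auto simp: max_def min_def image_image [symmetric] split: prod.splits)
qed

section \<open>Reaching boxes\<close>

text \<open>Ranks are strictly increasing on \<open>A\<close> and less than its cardinality, so
  counting shows that they exhaust the interval.\<close>

lemma rank_image:
  fixes A :: "int set"
  assumes "finite A"
  shows "(\<lambda>x. int (card {z. z < x \<and> z \<in> A})) ` A = {0..<int (card A)}"
proof (rule card_subset_eq)
  let ?r = "\<lambda>x. int (card {z. z < x \<and> z \<in> A})"
  have mono: "?r x < ?r x'" if "x < x'" "x \<in> A" for x x'
  proof -
    have "{z. z < x \<and> z \<in> A} \<subset> {z. z < x' \<and> z \<in> A}" using that by auto
    then show ?thesis using assms by (simp add: psubset_card_mono)
  qed
  have "card {z. z < x \<and> z \<in> A} < card A" if "x \<in> A" for x
    using assms that by (intro psubset_card_mono) auto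
  then show "?r ` A \<subseteq> {0..<int (card A)}" by auto
  have "inj_on ?r A" using mono by (metis (mono_tags, lifting) inj_onI less_irrefl linorder_less_linear)
  then show "card (?r ` A) = card {0..<int (card A)}" by (simp add: card_image)
qed simp

text \<open>With \<open>k\<close> this large every token reaches its resting column, which packs
  each row against the wall; equal row counts then give a rectangle.\<close>

lemma slide_full:
  assumes "finite S" and "\<And>x y. (x, y) \<in> S \<Longrightarrow> x - k \<le> Min (fst ` S)"
    and card: "\<And>y. y \<in> snd ` S \<Longrightarrow> card {x. (x, y) \<in> S} = b"
  shows "slide k S = {Min (fst ` S)..<Min (fst ` S) + int b} \<times> snd ` S"
proof -
  let ?m = "Min (fst ` S)"
  have "slide k S = (\<lambda>(x, y). (?m + rank S (x, y), y)) ` S"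
    unfolding slide_def
    by (intro image_cong) (use assms(2) in \<open>force simp: rank_def max_def\<close>)+
  also have "\<dots> = (\<Union>y \<in> snd ` S. (\<lambda>x. ?m + rank S (x, y)) ` {x. (x, y) \<in> S} \<times> {y})"
    by force
  also have "\<dots> = (\<Union>y \<in> snd ` S. {?m..<?m + int b} \<times> {y})"
  proof (intro SUP_cong refl arg_cong2 [where f = Sigma])
    fix y assume y: "y \<in> snd ` S"
    have "rank S (x, y) = int (card {z. z < x \<and> z \<in> {x. (x, y) \<in> S}})" for x
      by (simp add: rank_def)
    then have "(\<lambda>x. rank S (x, y)) ` {x. (x, y) \<in> S} = {0..<int b}"
      using rank_image [OF finite_row [OF assms(1), of y]] card [OF y] by simp
    moreover have "(\<lambda>x. ?m + rank S (x, y)) ` {x. (x, y) \<in> S} = (+) ?m ` (\<lambda>x. rank S (x, y)) ` {x. (x, y) \<in> S}"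
      by (simp add: image_image)
    ultimately show "(\<lambda>x. ?m + rank S (x, y)) ` {x. (x, y) \<in> S} = {?m..<?m + int b}"
      by (simp add: add.commute)
  qed
  also have "\<dots> = {?m..<?m + int b} \<times> snd ` S"
    by auto
  finally show ?thesis .
qed

lemma is_box_same_shape:
  assumes "S \<approx> T" and "is_box a b T"
  shows "is_box a b S"
proof -
  obtain u v x y where S: "S = translate u v ` ({x..<x + int a} \<times> {y..<y + int b})"
    using assms by (auto simp: same_shape_def is_box_def)
  have "S = {x + u..<x + u + int a} \<times> {y + v..<y + v + int b}"
  proof (intro set_eqI iffI)
    fix p assume "p \<in> {x + u..<x + u + int a} \<times> {y + v..<y + v + int b}"
    then have "p = translate u v (fst p - u, snd p - v)"
      "(fst p - u, snd p - v) \<in> {x..<x + int a} \<times> {y..<y + int b}" by auto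
    then show "p \<in> S" unfolding S by (rule image_eqI)
  qed (auto simp: S)
  then show ?thesis by (auto simp: is_box_def)
qed

lemma is_box_swap: "is_box a b S \<Longrightarrow> is_box b a (prod.swap ` S)"
  unfolding is_box_def using product_swap by metis

section \<open>Configurations from which a box can be made\<close>

definition makes_box :: "nat \<Rightarrow> nat \<Rightarrow> cell set \<Rightarrow> bool" where
  "makes_box a b S \<longleftrightarrow> (\<exists>ds. is_box a b (fold push ds S))"

lemma reaches_makes_box:
  assumes "reaches S T" and "makes_box a b T" and "finite T" and "T \<noteq> {}"
  shows "makes_box a b S"
proof -
  obtain ds es where ds: "fold push ds S \<approx> T" and es: "is_box a b (fold push es T)"
    using assms(1,2) by (auto simp: reaches_def makes_box_def)
  have "fold push (ds @ es) S \<approx> fold push es T"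
    using fold_push_cong [OF ds assms(3,4)] by simp
  then show ?thesis using es is_box_same_shape unfolding makes_box_def by blast
qed

lemma makes_box_swap:
  assumes "makes_box a b S"
  shows "makes_box b a (prod.swap ` S)"
proof -
  obtain ds where ds: "is_box a b (fold push ds S)" using assms by (auto simp: makes_box_def)
  have "reaches S (fold push ds S)" unfolding reaches_def using same_shape_refl by blast
  then obtain es where "fold push es (prod.swap ` S) \<approx> prod.swap ` fold push ds S"
    using reaches_swap unfolding reaches_def by blast
  then show ?thesis
    using is_box_same_shape is_box_swap [OF ds] unfolding makes_box_def by blast
qed

text \<open>Pushing down often enough packs all columns onto a common floor. The diagonal reflection
  turns this into \<open>slide_full\<close>, which speaks of rows.\<close>

lemma makes_boxI:
  assumes "finite S" and "S \<noteq> {}" and "fst ` S = {c..<c + int a}"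
    and card: "\<And>x. c \<le> x \<Longrightarrow> x < c + int a \<Longrightarrow> card {y. (x, y) \<in> S} = b"
  shows "makes_box a b S"
proof -
  let ?T = "prod.swap ` S"
  let ?m = "Min (fst ` ?T)"
  \<comment> \<open>The vertical extent of \<open>S\<close>: after that many pushes every token has
    come to rest.\<close>
  define k where "k = nat (Max (fst ` ?T) - ?m)"
  have T: "finite ?T" "snd ` ?T = {c..<c + int a}"
    using assms by (simp_all add: image_image)
  have le: "x - int k \<le> ?m" if "(x, y) \<in> ?T" for x y
  proof -
    have "x \<le> Max (fst ` ?T)" using T that by (intro Max_ge) force+
    then show ?thesis by (simp add: k_def)
  qed
  have "slide (int k) ?T = {?m..<?m + int b} \<times> snd ` ?T"
  proof (rule slide_full [OF T(1) le])
    fix y assume "y \<in> snd ` ?T"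
    then have "card {x. (y, x) \<in> S} = b" using card T(2) by simp
    moreover have "{x. (x, y) \<in> ?T} = {x. (y, x) \<in> S}" by force
    ultimately show "card {x. (x, y) \<in> ?T} = b" by simp
  qed
  then have "prod.swap ` slide (int k) ?T = {c..<c + int a} \<times> {?m..<?m + int b}"
    using T(2) by (simp add: product_swap)
  then have "is_box a b (prod.swap ` slide (int k) ?T)"
    unfolding is_box_def by blast
  moreover obtain ds where "fold push ds S \<approx> prod.swap ` slide (int k) ?T"
    using reaches_slide(3) [OF assms(1,2)] unfolding reaches_def by blast
  ultimately show ?thesis using is_box_same_shape unfolding makes_box_def by blast
qed

lemma sparse_inj:
  assumes "sparse S"
  shows "inj_on fst S" and "inj_on snd S"
  using assms by (simp_all add: sparse_def inj_on_def)

lemma sparse_swap: "sparse S \<Longrightarrow> sparse (prod.swap ` S)"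
  by (auto simp: sparse_def)

text \<open>Raising \<open>v\<close> to the next value of \<open>f\<close> on \<open>S\<close>
  admits exactly one more element, because \<open>f\<close> is injective.\<close>

lemma threshold:
  fixes f :: "'a \<Rightarrow> int"
  assumes "finite S" and "inj_on f S" and "k \<le> card S"
  shows "\<exists>v. card {p \<in> S. f p \<le> v} = k"
  using assms(3)
proof (induction k)
  case 0
  have "Min (f ` S) \<le> f p" if "p \<in> S" for p
    using that assms(1) by (intro Min_le) auto
  then have "{p \<in> S. f p \<le> Min (f ` S) - 1} = {}" by force
  then show ?case by (metis card.empty)
next
  case (Suc k)
  then obtain v where v: "card {p \<in> S. f p \<le> v} = k" by auto
  define B where "B = {p \<in> S. v < f p}"
  have "B \<noteq> {}"
  proof
    assume "B = {}"
    then have "{p \<in> S. f p \<le> v} = S" by (force simp: B_def)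
    then show False using v Suc.prems by simp
  qed
  then have "Min (f ` B) \<in> f ` B" using assms(1) by (intro Min_in) (auto simp: B_def)
  then obtain q where q: "q \<in> S" "v < f q" "f q = Min (f ` B)" by (auto simp: B_def)
  have "f q \<le> f p" if "p \<in> S" "v < f p" for p
    unfolding q(3) using that assms(1) by (intro Min_le) (auto simp: B_def)
  then have "{p \<in> S. f p \<le> f q} = insert q {p \<in> S. f p \<le> v}"
    using q(1,2) inj_onD [OF assms(2)] by force
  moreover have "card (insert q {p \<in> S. f p \<le> v}) = Suc k"
    using v q(2) assms(1) by (subst card_insert_disjoint) auto
  ultimately show ?case by metis
qed

lemma inj_on_map_fst: "inj_on snd S \<Longrightarrow> inj_on (\<lambda>(x, y). (f x, y)) S"
  and inj_on_map_snd: "inj_on fst S \<Longrightarrow> inj_on (\<lambda>(x, y). (x, f y)) S"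
  unfolding inj_on_def by force+

lemma inj_on_snd_image: "inj_on snd S \<Longrightarrow> inj_on snd ((\<lambda>(x, y). (f x, y)) ` S)"
  and inj_on_fst_image: "inj_on fst S \<Longrightarrow> inj_on fst ((\<lambda>(x, y). (x, f y)) ` S)"
  by (rule inj_on_imageI, simp add: comp_def case_prod_unfold)+

section \<open>Boxes with one or two columns\<close>

text \<open>Clamping at the rightmost occupied column collects all tokens there; they lie in
  distinct rows, so nothing collides.\<close>

lemma makes_box_1:
  assumes "finite S" and "card S = n" and "n > 0" and "sparse S"
  shows "makes_box 1 n S"
proof -
  define k where "k = Max (fst ` S)"
  define T where "T = (\<lambda>(x, y). (max k x, y)) ` S"
  have ne: "S \<noteq> {}" using assms by auto
  have le: "x \<le> k" if "(x, y) \<in> S" for x y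
    unfolding k_def using that assms(1) by (intro Max_ge) force+
  have T: "T = {k} \<times> snd ` S" unfolding T_def using le by (force simp: max_absorb1)
  have "reaches S T"
    unfolding T_def by (intro reaches_clamp assms ne inj_on_map_fst sparse_inj)
  moreover have "makes_box 1 n T"
  proof (rule makes_boxI)
    show "fst ` T = {k..<k + int 1}" using ne by (auto simp: T)
    show "card {y. (x, y) \<in> T} = n" if "k \<le> x" "x < k + int 1" for x
      using that assms(2) card_image [OF sparse_inj(2) [OF assms(4)]] by (simp add: T)
  qed (use assms(1) ne in \<open>auto simp: T\<close>)
  ultimately show ?thesis
    by (rule reaches_makes_box) (use assms(1) ne in \<open>auto simp: T\<close>)
qed

text \<open>A threshold \<open>k\<close> halves the tokens. Walls at \<open>k\<close> from the left
  and \<open>k + 1\<close> from the right sweep the halves into adjacent columns, without collisions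
  since the rows are distinct.\<close>

lemma makes_box_2:
  assumes "finite S" and "card S = 2 * b" and "b > 0" and "sparse S"
  shows "makes_box 2 b S"
proof -
  obtain k where k: "card {p \<in> S. fst p \<le> k} = b"
    using threshold [OF assms(1) sparse_inj(1) [OF assms(4)], of b] assms(2) by auto
  define L where "L = {p \<in> S. fst p \<le> k}"
  define R where "R = {p \<in> S. k < fst p}"
  have S: "S = L \<union> R" "L \<inter> R = {}" by (auto simp: L_def R_def)
  have fin: "finite L" "finite R" using assms(1) by (simp_all add: L_def R_def)
  have "card S = card L + card R" unfolding S(1) by (rule card_Un_disjoint [OF fin S(2)])
  then have "card L = b" "card R = b" using k assms(2) by (simp_all add: L_def)
  moreover have "inj_on snd L" "inj_on snd R"
    using sparse_inj(2) [OF assms(4)] by (auto simp: L_def R_def elim: inj_on_subset)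
  ultimately have card: "card (snd ` L) = b" "card (snd ` R) = b" by (simp_all add: card_image)
  define T where "T = (\<lambda>(x, y). (min (k + 1) x, y)) ` (\<lambda>(x, y). (max k x, y)) ` S"
  have ne: "S \<noteq> {}" using assms by auto
  have "T = (\<lambda>p. (k, snd p)) ` L \<union> (\<lambda>p. (k + 1, snd p)) ` R"
    unfolding T_def S(1) image_Un image_image
    by (intro arg_cong2 [where f = "(\<union>)"] image_cong) (auto simp: L_def R_def)
  then have T: "T = {k} \<times> snd ` L \<union> {k + 1} \<times> snd ` R" by auto
  have "reaches ((\<lambda>(x, y). (max k x, y)) ` S) T"
    unfolding T_def using assms(1) ne
    by (intro reaches_clamp inj_on_map_fst inj_on_snd_image sparse_inj assms(4)) auto
  moreover have "reaches S ((\<lambda>(x, y). (max k x, y)) ` S)"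
    by (intro reaches_clamp assms ne inj_on_map_fst sparse_inj)
  ultimately have "reaches S T"
    using reaches_trans [of S _ T] assms(1) ne by simp
  moreover have "makes_box 2 b T"
  proof (rule makes_boxI)
    have "L \<noteq> {}" "R \<noteq> {}" using card assms(3) by auto
    then have "fst ` T = {k, k + 1}" by (auto simp: T image_Un)
    then show "fst ` T = {k..<k + int 2}" by auto
    show "card {y. (x, y) \<in> T} = b" if x: "k \<le> x" "x < k + int 2" for x
    proof -
      consider "x = k" | "x = k + 1" using x by linarith
      then show ?thesis by cases (simp_all add: T card)
    qed
  qed (use assms(1) ne in \<open>auto simp: T_def\<close>)
  ultimately show ?thesis
    by (rule reaches_makes_box) (use assms(1) ne in \<open>auto simp: T_def\<close>)
qed


section \<open>The three by three box\<close>

lemma slide_row: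
  "{x. (x, y) \<in> slide k S} = (\<lambda>x. max (x - k) (Min (fst ` S) + rank S (x, y))) ` {x. (x, y) \<in> S}"
  by (auto simp: slide_def)

lemma card_slide_row:
  assumes "finite S"
  shows "card {x. (x, y) \<in> slide k S} = card {x. (x, y) \<in> S}"
  unfolding slide_row
proof (intro card_image inj_onI)
  fix x x' assume "x \<in> {x. (x, y) \<in> S}" "x' \<in> {x. (x, y) \<in> S}"
    and eq: "max (x - k) (Min (fst ` S) + rank S (x, y)) = max (x' - k) (Min (fst ` S) + rank S (x', y))"
  then show "x = x'"
    using slide_strict_mono [OF assms, of x y x' k "Min (fst ` S)"]
      slide_strict_mono [OF assms, of x' y x k "Min (fst ` S)"] by (cases x x' rule: linorder_cases) simp_all
qed

text \<open>Other rows may still be in motion: only the tokens of row \<open>y\<close> have to be at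
  rest, which is weaker than the hypothesis of \<open>slide_full\<close>.\<close>

lemma slide_row_full:
  assumes "finite S" and "\<And>x. (x, y) \<in> S \<Longrightarrow> x - k \<le> Min (fst ` S) + rank S (x, y)"
    and "card {x. (x, y) \<in> S} = b"
  shows "{x. (x, y) \<in> slide k S} = {Min (fst ` S)..<Min (fst ` S) + int b}"
proof -
  let ?m = "Min (fst ` S)"
  have "{x. (x, y) \<in> slide k S} = (\<lambda>x. ?m + rank S (x, y)) ` {x. (x, y) \<in> S}"
    unfolding slide_row using assms(2) by (intro image_cong) (auto simp: max_absorb2)
  also have "\<dots> = (+) ?m ` (\<lambda>x. rank S (x, y)) ` {x. (x, y) \<in> S}"
    by (simp add: image_image)
  also have "(\<lambda>x. rank S (x, y)) ` {x. (x, y) \<in> S} = {0..<int b}"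
    using rank_image [OF finite_row [OF assms(1), of y]] assms(3) by (simp add: rank_def)
  finally show ?thesis by (simp add: add.commute)
qed

text \<open>The mirrored rank counts the tokens to the right. Together with those to the left and
  the token itself they make up the row.\<close>

lemma rank_mirror:
  assumes "finite S" and "(x, y) \<in> S"
  shows "rank S (x, y) + rank (mirror ` S) (- x, y) + 1 = int (card {z. (z, y) \<in> S})"
proof -
  let ?A = "{z. z < x \<and> (z, y) \<in> S}" and ?B = "{z. x < z \<and> (z, y) \<in> S}"
  have "{z. z < - x \<and> (z, y) \<in> mirror ` S} = uminus ` ?B"
    by (force simp: image_iff mirror_def)
  then have "rank (mirror ` S) (- x, y) = int (card ?B)"
    by (simp add: rank_def card_image)
  moreover have "card {z. (z, y) \<in> S} = Suc (card ?A + card ?B)"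
  proof -
    have eq: "{z. (z, y) \<in> S} = insert x (?A \<union> ?B)" using assms(2) by auto
    have fin: "finite ?A" "finite ?B"
      using finite_row [OF assms(1), of y] by (auto intro: rev_finite_subset)
    then have "card (?A \<union> ?B) = card ?A + card ?B" by (intro card_Un_disjoint) auto
    then show ?thesis unfolding eq using fin by (subst card_insert_disjoint) auto
  qed
  ultimately show ?thesis by (simp add: rank_def)
qed

lemma Min_fst_mirror:
  assumes "finite S" and "S \<noteq> {}"
  shows "Min (fst ` mirror ` S) = - Max (fst ` S)"
proof (rule Min_eqI)
  have "Max (fst ` S) \<in> fst ` S" using assms by (intro Max_in) auto
  then show "- Max (fst ` S) \<in> fst ` mirror ` S" by (force simp: image_image mirror_def)
  fix z assume "z \<in> fst ` mirror ` S"
  then obtain x where "x \<in> fst ` S" "z = - x" by (force simp: mirror_def)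
  then show "- Max (fst ` S) \<le> z" using assms by simp
qed (use assms in simp)

lemma card_3_sorted:
  fixes A :: "int set"
  assumes "card A = 3"
  obtains x y z where "A = {x, y, z}" "x < y" "y < z"
proof -
  obtain x y z where A: "A = {x, y, z}" and ne: "x \<noteq> y" "y \<noteq> z" "x \<noteq> z"
    using assms by (auto simp: card_3_iff)
  have perm: "A = {x, z, y}" "A = {y, x, z}" "A = {y, z, x}" "A = {z, x, y}" "A = {z, y, x}"
    using A by auto
  from ne consider "x < y" "y < z" | "x < z" "z < y" | "y < x" "x < z" | "y < z" "z < x"
    | "z < x" "x < y" | "z < y" "y < x" by linarith
  then show ?thesis using that A perm by cases blast+
qed

text \<open>The three single tokens have to end up in three different adjacent columns, and the two
  rows of three have to fill just these columns. Each column then holds three tokens, and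
  \<open>makes_boxI\<close> finishes.\<close>

lemma makes_box_three_rows:
  assumes "card A = 3" and "card C = 3"
    and "x1 < x2" "x2 < x3" and "card {lo, hi, y1, y2, y3} = 5"
  shows "makes_box 3 3 (A \<times> {lo} \<union> C \<times> {hi} \<union> {(x1, y1), (x2, y2), (x3, y3)})" (is "makes_box 3 3 ?T")
proof -
  have fin: "finite A" "finite C" using assms(1,2) card.infinite by fastforce+
  have dist: "distinct [lo, hi, y1, y2, y3]"
    using assms(5) by (intro card_distinct) simp
  have T: "finite ?T" "?T \<noteq> {}" using fin by auto
  define m where "m = Min (fst ` ?T)"
  \<comment> \<open>This many left pushes bring the middle single token to column
    \<open>m + 1\<close>. The left one is stopped by the wall at \<open>m\<close>, and the right one
    stays beyond \<open>m + 1\<close>.\<close>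
  define U where "U = slide (x2 - 1 - m) ?T"
  define M where "M = Max (fst ` U)"
  \<comment> \<open>Now pushes to the right, in mirrored coordinates: a token at \<open>m\<close>
    advances to \<open>M - 2\<close> and one at \<open>m + 1\<close> to \<open>M - 1\<close>, so
    three columns remain.\<close>
  define V where "V = slide (M - (m + 2)) (mirror ` U)"
  have row_T: "{x. (x, lo) \<in> ?T} = A" "{x. (x, hi) \<in> ?T} = C" "{x. (x, y1) \<in> ?T} = {x1}"
    "{x. (x, y2) \<in> ?T} = {x2}" "{x. (x, y3) \<in> ?T} = {x3}"
    "\<And>y. y \<notin> {lo, hi, y1, y2, y3} \<Longrightarrow> {x. (x, y) \<in> ?T} = {}"
    using dist by auto
  have m: "m \<le> x1" unfolding m_def using T by (intro Min_fst_le [of _ _ y1]) auto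
  have rank_single: "rank S (x, y) = 0" if "{z. (z, y) \<in> S} = {x}" for S x y
  proof -
    have empty: "{z. z < x \<and> (z, y) \<in> S} = {}" using that by (auto simp: set_eq_iff)
    show ?thesis unfolding rank_def fst_conv snd_conv empty by simp
  qed
  have slide_single: "{z. (z, y) \<in> slide k S} = {max (x - k) (Min (fst ` S))}"
    if "{z. (z, y) \<in> S} = {x}" for k S x y
    unfolding slide_row that by (simp add: rank_single [OF that])
  have U: "finite U" "U \<noteq> {}" using T by (simp_all add: U_def)
  have MinU: "Min (fst ` U) = m"
    unfolding U_def m_def using T m assms(3) by (subst Min_fst_slide) (auto simp: m_def)
  have row_U: "card {x. (x, lo) \<in> U} = 3" "card {x. (x, hi) \<in> U} = 3" "{x. (x, y1) \<in> U} = {m}"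
    "{x. (x, y2) \<in> U} = {m + 1}" "{x. (x, y3) \<in> U} = {x3 - (x2 - 1 - m)}"
    "\<And>y. y \<notin> {lo, hi, y1, y2, y3} \<Longrightarrow> {x. (x, y) \<in> U} = {}"
    subgoal unfolding U_def card_slide_row [OF T(1)] row_T using assms by simp
    subgoal unfolding U_def card_slide_row [OF T(1)] row_T using assms by simp
    subgoal unfolding U_def slide_single [OF row_T(3)] m_def [symmetric] using assms by auto
    subgoal unfolding U_def slide_single [OF row_T(4)] m_def [symmetric] by auto
    subgoal unfolding U_def slide_single [OF row_T(5)] m_def [symmetric] using assms by auto
    subgoal unfolding U_def slide_row using row_T(6) by simp
    done
  have "(x3 - (x2 - 1 - m), y3) \<in> U" using row_U(5) by blast
  then have M: "x3 - (x2 - 1 - m) \<le> M" unfolding M_def using U by (intro Max_ge) force+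
  then have M2: "m + 2 \<le> M" using assms(4) by linarith
  have MinV: "Min (fst ` mirror ` U) = - M" unfolding M_def by (rule Min_fst_mirror [OF U])
  have row_mirror: "{x. (x, y) \<in> mirror ` U} = uminus ` {x. (x, y) \<in> U}" for y
    by (force simp: image_iff mirror_def)
  \<comment> \<open>In a row of three, a token with \<open>r\<close> others on its left starts at
    \<open>m + r\<close> or further right and rests at \<open>M - 2 + r\<close>;
    \<open>M - (m + 2)\<close> pushes therefore suffice.\<close>
  have full: "{x. (x, y) \<in> V} = {- M..<- M + 3}" if y: "card {x. (x, y) \<in> U} = 3" for y
  proof -
    have "z - (M - (m + 2)) \<le> - M + rank (mirror ` U) (z, y)" if "(z, y) \<in> mirror ` U" for z
    proof -
      have z: "(- z, y) \<in> U" using that by (force simp: mirror_def)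
      show ?thesis
        using rank_mirror [OF U(1) z] y gap_iff(2) [OF U(1) z] unfolding MinU by simp
    qed
    moreover have "card {x. (x, y) \<in> mirror ` U} = 3"
      unfolding row_mirror using y by (simp add: card_image)
    ultimately show ?thesis
      unfolding V_def using slide_row_full [of "mirror ` U" y "M - (m + 2)" 3] U(1)
      unfolding MinV by simp
  qed
  have row_mU: "{x. (x, y1) \<in> mirror ` U} = {- m}" "{x. (x, y2) \<in> mirror ` U} = {- m - 1}"
    "{x. (x, y3) \<in> mirror ` U} = {- (x3 - (x2 - 1 - m))}"
    unfolding row_mirror row_U by auto
  have row_V: "{x. (x, lo) \<in> V} = {- M..<- M + 3}" "{x. (x, hi) \<in> V} = {- M..<- M + 3}"
    "{x. (x, y1) \<in> V} = {2 - M}" "{x. (x, y2) \<in> V} = {1 - M}" "{x. (x, y3) \<in> V} = {- M}"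
    "\<And>y. y \<notin> {lo, hi, y1, y2, y3} \<Longrightarrow> {x. (x, y) \<in> V} = {}"
    subgoal using full row_U(1) by simp
    subgoal using full row_U(2) by simp
    subgoal unfolding V_def slide_single [OF row_mU(1)] MinV using M2 by auto
    subgoal unfolding V_def slide_single [OF row_mU(2)] MinV using M2 by auto
    subgoal unfolding V_def slide_single [OF row_mU(3)] MinV using assms(4) by auto
    subgoal unfolding V_def slide_row row_mirror using row_U(6) by simp
    done
  have mem: "(x, y) \<in> V \<longleftrightarrow> y \<in> {lo, hi} \<and> - M \<le> x \<and> x < - M + 3 \<or> y = y1 \<and> x = 2 - M
      \<or> y = y2 \<and> x = 1 - M \<or> y = y3 \<and> x = - M" for x y
  proof (cases "y \<in> {lo, hi, y1, y2, y3}")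
    case True
    then consider "y = lo" | "y = hi" | "y = y1" | "y = y2" | "y = y3" by blast
    then show ?thesis
      by cases (use dist row_V(1-5) in \<open>auto simp: set_eq_iff\<close>)
  next
    case False
    then show ?thesis using row_V(6) [OF False] by auto
  qed
  let ?W = "mirror ` V"
  have memW: "(x, y) \<in> ?W \<longleftrightarrow> (- x, y) \<in> V" for x y
    by (force simp: mirror_def image_iff)
  have "makes_box 3 3 ?W"
  proof (rule makes_boxI)
    show "finite ?W" using U by (simp add: V_def)
    show "?W \<noteq> {}" using U by (simp add: V_def)
    show "fst ` ?W = {M - 2..<M - 2 + int 3}"
    proof (intro set_eqI iffI)
      fix x assume "x \<in> fst ` ?W"
      then obtain y where "(- x, y) \<in> V" using memW by force
      then have "- M \<le> - x \<and> - x < - M + 3" unfolding mem by linarith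
      then show "x \<in> {M - 2..<M - 2 + int 3}" by simp
    next
      fix x assume "x \<in> {M - 2..<M - 2 + int 3}"
      then have "(- x, lo) \<in> V" unfolding mem by simp
      then show "x \<in> fst ` ?W" using memW by force
    qed
    fix x assume x: "M - 2 \<le> x" "x < M - 2 + int 3"
    then consider "x = M - 2" | "x = M - 1" | "x = M" by linarith
    then have "\<exists>y. {y. (x, y) \<in> ?W} = {lo, hi, y} \<and> y \<noteq> lo \<and> y \<noteq> hi"
      by cases (use dist in \<open>auto simp: memW mem intro!: exI\<close>)
    then obtain y where "{y. (x, y) \<in> ?W} = {lo, hi, y}" "y \<noteq> lo" "y \<noteq> hi" by blast
    then show "card {y. (x, y) \<in> ?W} = 3" using dist by simp
  qed
  moreover have "reaches U ?W"
    using reaches_slide(2) [OF U, of "nat (M - (m + 2))"] M2 by (simp add: V_def)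
  moreover have "reaches ?T U"
    using reaches_slide(1) [OF T, of "nat (x2 - 1 - m)"] m assms(3) by (simp add: U_def)
  ultimately show ?thesis
    using reaches_makes_box U by (metis finite_imageI finite_slide image_is_empty slide_empty_iff V_def)
qed


text \<open>The three lowest and the three highest tokens are clamped into one row each. Sparseness
  gives distinct columns, so both clamps are injective.\<close>

lemma makes_box_3:
  assumes "finite S" and "card S = 9" and "sparse S"
  shows "makes_box 3 3 S"
proof -
  note inj = sparse_inj [OF assms(3)]
  obtain lo where lo: "card {p \<in> S. snd p \<le> lo} = 3"
    using threshold [OF assms(1) inj(2), of 3] assms(2) by auto
  obtain v where v: "card {p \<in> S. snd p \<le> v} = 6"
    using threshold [OF assms(1) inj(2), of 6] assms(2) by auto
  \<comment> \<open>The first row above the six lowest tokens: clamping from above to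
    \<open>hi\<close> affects none of the middle three, whose rows all lie strictly between
    \<open>lo\<close> and \<open>hi\<close>.\<close>
  define hi where "hi = v + 1"
  define A where "A = {p \<in> S. snd p \<le> lo}"
  define B where "B = {p \<in> S. lo < snd p \<and> snd p < hi}"
  define C where "C = {p \<in> S. hi \<le> snd p}"
  have "lo < v"
  proof (rule ccontr)
    assume "\<not> lo < v"
    then have "{p \<in> S. snd p \<le> v} \<subseteq> {p \<in> S. snd p \<le> lo}" by auto
    then show False using card_mono [of "{p \<in> S. snd p \<le> lo}" "{p \<in> S. snd p \<le> v}"] assms(1) lo v by simp
  qed
  then have lohi: "lo < hi" by (simp add: hi_def)
  have fin: "finite A" "finite B" "finite C" using assms(1) by (simp_all add: A_def B_def C_def)
  have disj: "A \<inter> B = {}" "(A \<union> B) \<inter> C = {}" using lohi by (auto simp: A_def B_def C_def)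
  have AB: "A \<union> B = {p \<in> S. snd p \<le> v}" using \<open>lo < v\<close> by (auto simp: A_def B_def hi_def)
  have S: "S = A \<union> B \<union> C" using lohi by (auto simp: A_def B_def C_def)
  have cardA: "card A = 3" using lo by (simp add: A_def)
  have cardB: "card B = 3"
    using card_Un_disjoint [OF fin(1,2) disj(1)] v cardA by (simp add: AB)
  have cardC: "card C = 3"
    using card_Un_disjoint [OF finite_UnI [OF fin(1,2)] fin(3) disj(2)] assms(2) v
    unfolding S [symmetric] unfolding AB by simp
  have injs: "inj_on fst A" "inj_on fst B" "inj_on fst C" "inj_on snd B"
    using inj by (auto simp: A_def B_def C_def elim: inj_on_subset)
  have cards: "card (fst ` A) = 3" "card (fst ` B) = 3" "card (fst ` C) = 3" "card (snd ` B) = 3"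
    using injs cardA cardB cardC by (simp_all add: card_image)
  obtain x1 x2 x3 where x: "fst ` B = {x1, x2, x3}" "x1 < x2" "x2 < x3"
    using card_3_sorted [OF cards(2)] .
  then have "x1 \<in> fst ` B" "x2 \<in> fst ` B" "x3 \<in> fst ` B" by simp_all
  then obtain y1 y2 y3 where y: "(x1, y1) \<in> B" "(x2, y2) \<in> B" "(x3, y3) \<in> B" by force
  have B: "{(x1, y1), (x2, y2), (x3, y3)} = B"
    using y x cardB fin(2) by (intro card_subset_eq) auto
  then have sndB: "snd ` B = {y1, y2, y3}" by force
  have "lo \<notin> snd ` B" "hi \<notin> snd ` B" "lo \<noteq> hi" using lohi by (auto simp: B_def)
  then have card5: "card {lo, hi, y1, y2, y3} = 5"
    using cards(4) unfolding sndB by simp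
  define T where "T = (\<lambda>(x, y). (x, min hi y)) ` (\<lambda>(x, y). (x, max lo y)) ` S"
  have "T = (\<lambda>p. (fst p, lo)) ` A \<union> (\<lambda>p. p) ` B \<union> (\<lambda>p. (fst p, hi)) ` C"
    unfolding T_def S image_Un image_image using lohi
    by (intro arg_cong2 [where f = "(\<union>)"] image_cong) (auto simp: A_def B_def C_def)
  then have "T = fst ` A \<times> {lo} \<union> fst ` C \<times> {hi} \<union> {(x1, y1), (x2, y2), (x3, y3)}"
    unfolding B by auto
  then have "makes_box 3 3 T"
    using makes_box_three_rows [OF cards(1) cards(3) x(2,3) card5] by simp
  have ne: "S \<noteq> {}" using assms(2) by auto
  have "reaches S ((\<lambda>(x, y). (x, max lo y)) ` S)"
    by (intro reaches_clamp assms ne inj_on_map_snd inj)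
  moreover have "reaches ((\<lambda>(x, y). (x, max lo y)) ` S) T"
    unfolding T_def using assms(1) ne
    by (intro reaches_clamp inj_on_map_snd inj_on_fst_image inj) auto
  ultimately have "reaches S T"
    using reaches_trans [of S _ T] assms(1) ne by simp
  then show ?thesis
    by (rule reaches_makes_box) (use \<open>makes_box 3 3 T\<close> assms(1) ne in \<open>auto simp: T_def\<close>)
qed

section \<open>Unreachable boxes\<close>

text \<open>Columns are compared with \<open>b\<close> and rows with \<open>a\<close>, since an
  \<open>a \<times> b\<close> box has \<open>a\<close> columns of \<open>b\<close> tokens.\<close>

definition overfull :: "nat \<Rightarrow> nat \<Rightarrow> cell set \<Rightarrow> bool" where
  "overfull a b S \<longleftrightarrow> (\<exists>x. b < card {y. (x, y) \<in> S}) \<or> (\<exists>y. a < card {x. (x, y) \<in> S})"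

lemma overfull_swap: "overfull a b S \<Longrightarrow> overfull b a (prod.swap ` S)"
proof -
  have "(x, y) \<in> prod.swap ` S \<longleftrightarrow> (y, x) \<in> S" for x y by force
  then show "overfull a b S \<Longrightarrow> overfull b a (prod.swap ` S)"
    unfolding overfull_def by auto
qed

lemma overfull_mirror: "overfull a b S \<Longrightarrow> overfull a b (mirror ` S)"
proof -
  have mem: "(x, y) \<in> mirror ` S \<longleftrightarrow> (- x, y) \<in> S" for x y
    by (force simp: mirror_def image_iff)
  have "{x. (- x, y) \<in> S} = uminus ` {x. (x, y) \<in> S}" for y by (force simp: image_iff)
  then have "card {x. (- x, y) \<in> S} = card {x. (x, y) \<in> S}" for y by (simp add: card_image)
  then show "overfull a b S \<Longrightarrow> overfull a b (mirror ` S)"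
    unfolding overfull_def mem by (metis minus_minus)
qed

lemma overfull_same_shape:
  assumes "S \<approx> T" and "overfull a b T"
  shows "overfull a b S"
proof -
  obtain u v where S: "S = translate u v ` T" using assms by (auto simp: same_shape_def)
  have mem: "(x, y) \<in> S \<longleftrightarrow> (x - u, y - v) \<in> T" for x y
    unfolding S by (force simp: translate_def image_iff)
  have "{x. (x - u, y) \<in> T} = (\<lambda>x. x + u) ` {x. (x, y) \<in> T}"
    "{y. (x, y - v) \<in> T} = (\<lambda>y. y + v) ` {y. (x, y) \<in> T}" for x y
    by (force simp: image_iff)+
  then have c: "card {x. (x - u, y) \<in> T} = card {x. (x, y) \<in> T}"
    "card {y. (x, y - v) \<in> T} = card {y. (x, y) \<in> T}" for x y
    by (simp_all add: card_image)
  show ?thesis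
    using assms(2) c unfolding overfull_def mem by (metis add_diff_cancel_right')
qed

text \<open>Row counts do not change. A token of a crowded column either moves one column to the
  left or is blocked; in the latter case its row is full from the wall on and stays so. Either way
  its row is occupied in the column \<open>x'\<close> afterwards.\<close>

lemma overfull_slide:
  assumes "finite S" and "overfull a b S"
  shows "overfull a b (slide 1 S)"
proof -
  let ?m = "Min (fst ` S)"
  from assms(2) consider x where "b < card {y. (x, y) \<in> S}" | y where "a < card {x. (x, y) \<in> S}"
    unfolding overfull_def by blast
  then show ?thesis
  proof cases
    case 1
    define x' where "x' = max (x - 1) ?m"
    have "{y. (x, y) \<in> S} \<subseteq> {y. (x', y) \<in> slide 1 S}"
    proof clarify
      fix y assume p: "(x, y) \<in> S"
      have slide: "(max (z - 1) (?m + rank S (z, y)), y) \<in> slide 1 S" if "(z, y) \<in> S" for z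
        unfolding slide_def using that by force
      note gap = gap_iff [OF assms(1)]
      show "(x', y) \<in> slide 1 S"
      proof (cases "x > ?m + rank S (x, y)")
        case True
        moreover have "0 \<le> rank S (x, y)" by (simp add: rank_def)
        ultimately have "max (x - 1) (?m + rank S (x, y)) = x'"
          unfolding x'_def by (auto simp: max_def)
        then show ?thesis using slide [OF p] by simp
      next
        case False
        then have filled: "(z, y) \<in> S" if "?m \<le> z" "z < x" for z
          using gap(1) [OF p] that by blast
        have "?m \<le> x'" "x' \<le> x" using Min_fst_le [OF assms(1) p] by (auto simp: x'_def)
        then have "(x', y) \<in> S" using filled p by (cases "x' = x") auto
        moreover have "?m + rank S (x', y) = x'"
          using gap [OF \<open>(x', y) \<in> S\<close>] filled \<open>x' \<le> x\<close> by (metis less_le_trans order_le_less)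
        ultimately show ?thesis using slide [of x'] by simp
      qed
    qed
    then have "card {y. (x, y) \<in> S} \<le> card {y. (x', y) \<in> slide 1 S}"
      using assms(1) by (intro card_mono finite_subset [of "{y. (x', y) \<in> slide 1 S}" "snd ` slide 1 S"]) force+
    then show ?thesis using 1 unfolding overfull_def by (meson less_le_trans)
  next
    case 2
    then show ?thesis unfolding overfull_def using card_slide_row [OF assms(1)] by metis
  qed
qed

lemma overfull_push_left:
  assumes "finite S" and "S \<noteq> {}" and "overfull a b S"
  shows "overfull a b (push_left S)"
  using overfull_same_shape [OF push_left_slide overfull_slide] assms by blast

lemma box_not_overfull: "is_box a b S \<Longrightarrow> \<not> overfull a b S"
proof -
  assume "is_box a b S"
  then obtain x y where S: "S = {x..<x + int a} \<times> {y..<y + int b}" by (auto simp: is_box_def)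
  have "card {v. (u, v) \<in> S} \<le> b" for u
  proof -
    have "{v. (u, v) \<in> S} \<subseteq> {y..<y + int b}" by (auto simp: S)
    from card_mono [OF _ this] show ?thesis by simp
  qed
  moreover have "card {u. (u, v) \<in> S} \<le> a" for v
  proof -
    have "{u. (u, v) \<in> S} \<subseteq> {x..<x + int a}" by (auto simp: S)
    from card_mono [OF _ this] show ?thesis by simp
  qed
  ultimately show ?thesis unfolding overfull_def by (simp add: not_less)
qed


section \<open>Configurations confined by four walls\<close>

definition clamp :: "int \<Rightarrow> int \<Rightarrow> int \<Rightarrow> int \<Rightarrow> cell \<Rightarrow> cell" where
  "clamp l r d u = (\<lambda>(x, y). (max l (min r x), max d (min u y)))"

text \<open>The four inequalities say that no two tokens lie in a common corner rectangle of
  semiperimeter less than \<open>s\<close>; hence walls that have swept little enough cause no collisions.\<close>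

definition spread :: "int \<Rightarrow> int \<Rightarrow> cell set \<Rightarrow> bool" where
  "spread n s P \<longleftrightarrow> inj_on fst P \<and> inj_on snd P \<and> fst ` P = {0..<n} \<and> snd ` P = {0..<n} \<and>
     (\<forall>x y x' y'. (x, y) \<in> P \<longrightarrow> (x', y') \<in> P \<longrightarrow> (x, y) \<noteq> (x', y') \<longrightarrow>
        s \<le> max x x' + max y y' \<and> s \<le> max (n - 1 - x) (n - 1 - x') + max y y' \<and>
        s \<le> max x x' + max (n - 1 - y) (n - 1 - y') \<and>
        s \<le> max (n - 1 - x) (n - 1 - x') + max (n - 1 - y) (n - 1 - y'))"

text \<open>The numbers \<open>l\<close>, \<open>r\<close>, \<open>d\<close>, \<open>u\<close> tell
  how far each wall has advanced. A left wall at \<open>l\<close> has gathered the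
  \<open>l + 1\<close> tokens of columns 0 to \<open>l\<close>, so \<open>l < int b\<close> means at
  most \<open>b\<close> of them. Leaving \<open>P\<close> existential lets reflections replace it by
  its mirror image.\<close>

definition confined :: "nat \<Rightarrow> nat \<Rightarrow> int \<Rightarrow> cell set \<Rightarrow> bool" where
  "confined a b n S \<longleftrightarrow> (\<exists>P l r d u. spread n (int a + int b) P \<and>
     0 \<le> l \<and> l < int b \<and> 0 \<le> r \<and> r < int b \<and> 0 \<le> d \<and> d < int a \<and> 0 \<le> u \<and> u < int a \<and>
     S \<approx> clamp l (n - 1 - r) d (n - 1 - u) ` P)"

lemma spread_finite: "spread n s P \<Longrightarrow> finite P"
  unfolding spread_def by (metis finite_atLeastLessThan_int finite_imageD)

lemma spreadI:
  assumes "inj_on fst P" and "inj_on snd P" and "fst ` P = {0..<n}" and "snd ` P = {0..<n}"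
    and "\<And>x y x' y'. (x, y) \<in> P \<Longrightarrow> (x', y') \<in> P \<Longrightarrow> (x, y) \<noteq> (x', y') \<Longrightarrow>
      s \<le> max x x' + max y y' \<and> s \<le> max (n - 1 - x) (n - 1 - x') + max y y' \<and>
      s \<le> max x x' + max (n - 1 - y) (n - 1 - y') \<and>
      s \<le> max (n - 1 - x) (n - 1 - x') + max (n - 1 - y) (n - 1 - y')"
  shows "spread n s P"
  unfolding spread_def by (intro conjI allI impI assms(1-4)) (frule (2) assms(5); simp)+

lemma spreadD:
  assumes "spread n s P" and "(x, y) \<in> P" and "(x', y') \<in> P" and "(x, y) \<noteq> (x', y')"
  shows "s \<le> max x x' + max y y'" and "s \<le> max (n - 1 - x) (n - 1 - x') + max y y'"
    and "s \<le> max x x' + max (n - 1 - y) (n - 1 - y')"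
    and "s \<le> max (n - 1 - x) (n - 1 - x') + max (n - 1 - y) (n - 1 - y')"
  using assms(1) [unfolded spread_def, THEN conjunct2, THEN conjunct2, THEN conjunct2, THEN conjunct2,
      rule_format, OF assms(2-)] by simp_all

lemma spread_swap:
  assumes "spread n s P"
  shows "spread n s (prod.swap ` P)"
proof (rule spreadI)
  show "fst ` prod.swap ` P = {0..<n}" "snd ` prod.swap ` P = {0..<n}"
    using assms by (simp_all add: spread_def image_image)
  show "inj_on fst (prod.swap ` P)" "inj_on snd (prod.swap ` P)"
    using assms by (auto simp: spread_def inj_on_def)
  fix x y x' y'
  assume "(x, y) \<in> prod.swap ` P" "(x', y') \<in> prod.swap ` P" "(x, y) \<noteq> (x', y')"
  then have "(y, x) \<in> P" "(y', x') \<in> P" "(y, x) \<noteq> (y', x')" by auto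
  from spreadD [OF assms this]
  show "s \<le> max x x' + max y y' \<and> s \<le> max (n - 1 - x) (n - 1 - x') + max y y' \<and>
      s \<le> max x x' + max (n - 1 - y) (n - 1 - y') \<and>
      s \<le> max (n - 1 - x) (n - 1 - x') + max (n - 1 - y) (n - 1 - y')"
    by (simp add: add.commute)
qed

lemma spread_reflect:
  assumes "spread n s P"
  shows "spread n s ((\<lambda>(x, y). (n - 1 - x, y)) ` P)" (is "spread n s (?f ` P)")
proof (rule spreadI)
  have inj: "inj_on fst P" "inj_on snd P" and im: "fst ` P = {0..<n}" "snd ` P = {0..<n}"
    using assms by (auto simp: spread_def)
  have "fst ` ?f ` P = (\<lambda>x. n - 1 - x) ` fst ` P"
    by (simp add: image_image case_prod_unfold)
  moreover have "(\<lambda>x. n - 1 - x) ` {0..<n} = {0..<n}"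
  proof (intro set_eqI iffI)
    fix x assume "x \<in> {0..<n}"
    then show "x \<in> (\<lambda>x. n - 1 - x) ` {0..<n}" by (intro image_eqI [of _ _ "n - 1 - x"]) auto
  qed auto
  ultimately show "fst ` ?f ` P = {0..<n}" by (simp only: im)
  show "snd ` ?f ` P = {0..<n}" unfolding im(2) [symmetric] by (simp add: image_image case_prod_unfold)
  show "inj_on fst (?f ` P)" "inj_on snd (?f ` P)"
    using inj unfolding inj_on_def by force+
  fix x y x' y'
  assume "(x, y) \<in> ?f ` P" "(x', y') \<in> ?f ` P" "(x, y) \<noteq> (x', y')"
  then obtain z z' where "(z, y) \<in> P" "(z', y') \<in> P" "(z, y) \<noteq> (z', y')"
    and [simp]: "x = n - 1 - z" "x' = n - 1 - z'" by auto
  from spreadD [OF assms this(1-3)]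
  show "s \<le> max x x' + max y y' \<and> s \<le> max (n - 1 - x) (n - 1 - x') + max y y' \<and>
      s \<le> max x x' + max (n - 1 - y) (n - 1 - y') \<and>
      s \<le> max (n - 1 - x) (n - 1 - x') + max (n - 1 - y) (n - 1 - y')"
    by simp
qed

lemma clamp_eqD:
  fixes x :: int
  assumes "x \<noteq> x'" and "max l (min r x) = max l (min r x')" and "l < r"
  shows "x \<le> l \<and> x' \<le> l \<or> r \<le> x \<and> r \<le> x'"
  using assms by linarith

text \<open>Tokens with the same image were caught by the same vertical and the same horizontal
  wall. They thus share a corner rectangle, too small for two tokens of \<open>P\<close>.\<close>

lemma clamp_inj:
  assumes P: "spread n s P" and "0 \<le> l" "0 \<le> r" "0 \<le> d" "0 \<le> u"
    and s: "l + d < s" "l + u < s" "r + d < s" "r + u < s"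
    and "l < n - 1 - r" "d < n - 1 - u"
  shows "inj_on (clamp l (n - 1 - r) d (n - 1 - u)) P"
proof (rule inj_onI, rule ccontr)
  fix p q
  assume pq: "p \<in> P" "q \<in> P" "clamp l (n - 1 - r) d (n - 1 - u) p = clamp l (n - 1 - r) d (n - 1 - u) q"
    and ne: "p \<noteq> q"
  have "fst p \<noteq> fst q" "snd p \<noteq> snd q"
    using P pq ne by (auto simp: spread_def inj_on_def)
  moreover have "max l (min (n - 1 - r) (fst p)) = max l (min (n - 1 - r) (fst q))"
    "max d (min (n - 1 - u) (snd p)) = max d (min (n - 1 - u) (snd q))"
    using pq(3) by (auto simp: clamp_def case_prod_unfold)
  ultimately have "fst p \<le> l \<and> fst q \<le> l \<or> n - 1 - r \<le> fst p \<and> n - 1 - r \<le> fst q"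
    "snd p \<le> d \<and> snd q \<le> d \<or> n - 1 - u \<le> snd p \<and> n - 1 - u \<le> snd q"
    using assms(10,11) clamp_eqD by blast+
  moreover have "s \<le> max (fst p) (fst q) + max (snd p) (snd q)"
    "s \<le> max (n - 1 - fst p) (n - 1 - fst q) + max (snd p) (snd q)"
    "s \<le> max (fst p) (fst q) + max (n - 1 - snd p) (n - 1 - snd q)"
    "s \<le> max (n - 1 - fst p) (n - 1 - fst q) + max (n - 1 - snd p) (n - 1 - snd q)"
    using spreadD [OF P, of "fst p" "snd p" "fst q" "snd q"] pq(1,2) ne by (auto simp: prod_eq_iff)
  ultimately show False using s by linarith
qed

lemma confined_swap:
  assumes "confined a b n S"
  shows "confined b a n (prod.swap ` S)"
proof -
  obtain P l r d u where P: "spread n (int a + int b) P"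
    "0 \<le> l" "l < int b" "0 \<le> r" "r < int b" "0 \<le> d" "d < int a" "0 \<le> u" "u < int a"
    and S: "S \<approx> clamp l (n - 1 - r) d (n - 1 - u) ` P"
    using assms by (auto simp: confined_def)
  have "prod.swap ` clamp l (n - 1 - r) d (n - 1 - u) ` P = clamp d (n - 1 - u) l (n - 1 - r) ` prod.swap ` P"
    unfolding image_image by (intro image_cong) (auto simp: clamp_def)
  then have "prod.swap ` S \<approx> clamp d (n - 1 - u) l (n - 1 - r) ` prod.swap ` P"
    using same_shape_swap [OF S] by simp
  moreover have "spread n (int b + int a) (prod.swap ` P)"
    using spread_swap [OF P(1)] by (simp add: add.commute)
  ultimately show ?thesis using P unfolding confined_def by blast
qed

lemma confined_mirror:
  assumes "confined a b n S" and "2 * int b \<le> n"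
  shows "confined a b n (mirror ` S)"
proof -
  obtain P l r d u where P: "spread n (int a + int b) P"
    "0 \<le> l" "l < int b" "0 \<le> r" "r < int b" "0 \<le> d" "d < int a" "0 \<le> u" "u < int a"
    and S: "S \<approx> clamp l (n - 1 - r) d (n - 1 - u) ` P"
    using assms by (auto simp: confined_def)
  let ?Q = "(\<lambda>(x, y). (n - 1 - x, y)) ` P"
  \<comment> \<open>The walls have not crossed, so \<open>max\<close> and \<open>min\<close> in
    \<open>clamp\<close> may be interchanged, as the reflection does.\<close>
  have "l \<le> n - 1 - r" using P assms(2) by linarith
  then have "mirror ` clamp l (n - 1 - r) d (n - 1 - u) ` P =
      translate (1 - n) 0 ` clamp r (n - 1 - l) d (n - 1 - u) ` ?Q"
    unfolding image_image by (intro image_cong) (auto simp: clamp_def max_def min_def)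
  then have "mirror ` S \<approx> clamp r (n - 1 - l) d (n - 1 - u) ` ?Q"
    using same_shape_trans [OF same_shape_mirror [OF S]] by simp
  then show ?thesis using P spread_reflect [OF P(1)] unfolding confined_def by blast
qed


text \<open>A push advances the left wall from \<open>l\<close> to \<open>l + 1\<close> without
  collisions. Either this is still below \<open>b\<close>, or the wall now holds
  \<open>b + 1\<close> tokens in one column.\<close>

lemma confined_push_left:
  assumes "confined a b n S" and "finite S" and "S \<noteq> {}" and n: "2 * int a < n" "2 * int b < n"
  shows "confined a b n (push_left S) \<or> overfull a b (push_left S)"
proof -
  obtain P l r d u where P: "spread n (int a + int b) P"
    and lr: "0 \<le> l" "l < int b" "0 \<le> r" "r < int b" and du: "0 \<le> d" "d < int a" "0 \<le> u" "u < int a"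
    and S: "S \<approx> clamp l (n - 1 - r) d (n - 1 - u) ` P"
    using assms(1) by (auto simp: confined_def)
  define C where "C = clamp l (n - 1 - r) d (n - 1 - u) ` P"
  define C' where "C' = clamp (l + 1) (n - 1 - r) d (n - 1 - u) ` P"
  have im: "fst ` P = {0..<n}" and injP: "inj_on fst P" using P by (auto simp: spread_def)
  have finP: "finite P" "P \<noteq> {}" using spread_finite [OF P] im lr n by auto
  have C: "finite C" "C \<noteq> {}" using finP by (simp_all add: C_def)
  have Min: "Min (fst ` C) = l"
  proof (rule Min_eqI)
    have "0 \<in> fst ` P" using im lr n by simp
    then obtain y where y: "(0, y) \<in> P" by force
    have "fst (clamp l (n - 1 - r) d (n - 1 - u) (0, y)) = l"
      using lr n by (simp add: clamp_def)
    then show "l \<in> fst ` C" unfolding C_def using y by (metis image_eqI)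
    show "l \<le> z" if "z \<in> fst ` C" for z
      using that by (auto simp: C_def clamp_def)
  qed (use C in simp)
  \<comment> \<open>Here the parameter \<open>int a + int b\<close> of \<open>spread\<close> is
    exactly enough: \<open>l + 1\<close> is at most \<open>b\<close>, while \<open>d\<close> and
    \<open>u\<close> are at most \<open>a - 1\<close>.\<close>
  have inj': "inj_on (clamp (l + 1) (n - 1 - r) d (n - 1 - u)) P"
    by (rule clamp_inj [OF P]) (use lr du n in linarith)+
  have comp: "(\<lambda>(x, y). (max (l + 1) x, y)) \<circ> clamp l (n - 1 - r) d (n - 1 - u) =
      clamp (l + 1) (n - 1 - r) d (n - 1 - u)"
    by (auto simp: clamp_def)
  have img: "(\<lambda>(x, y). (max (l + 1) x, y)) ` C = C'"
    unfolding C_def C'_def image_comp comp ..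
  have "inj_on (\<lambda>(x, y). (max (l + 1) x, y)) C"
    unfolding C_def by (rule inj_on_imageI) (simp only: comp inj')
  then have "slide 1 C \<approx> C'"
    using slide_clamp [OF C(1), of "l + 1"] unfolding Min img by simp
  then have push: "push_left S \<approx> C'"
    using push_left_cong [OF S [folded C_def] C] same_shape_trans [OF push_left_slide [OF C]] by simp
  show ?thesis
  proof (cases "l + 1 < int b")
    case True
    then have "confined a b n (push_left S)"
      unfolding confined_def using P lr du push [unfolded C'_def]
      by (intro exI [of _ P] exI [of _ "l + 1"] exI [of _ r] exI [of _ d] exI [of _ u]) simp
    then show ?thesis ..
  next
    case False
    then have b: "l + 1 = int b" using lr by simp
    \<comment> \<open>The tokens of columns 0 to \<open>b\<close>, hence \<open>b + 1\<close> of
      them, all swept into column \<open>b\<close>.\<close>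
    define L where "L = {p \<in> P. fst p \<le> int b}"
    let ?c = "clamp (l + 1) (n - 1 - r) d (n - 1 - u)"
    have "fst ` L = {z \<in> fst ` P. z \<le> int b}" by (auto simp: L_def)
    then have "fst ` L = {0..int b}" unfolding im using n by auto
    moreover have "inj_on fst L" using injP by (rule inj_on_subset) (auto simp: L_def)
    ultimately have "card L = b + 1" using card_image [of fst L] by simp
    moreover have "inj_on ?c L" using inj' by (rule inj_on_subset) (auto simp: L_def)
    ultimately have "card (?c ` L) = b + 1" by (simp add: card_image)
    moreover have col: "fst p = int b" if "p \<in> ?c ` L" for p
      using that lr n b by (auto simp: L_def clamp_def)
    then have "inj_on snd (?c ` L)"
      by (intro inj_onI) (metis prod_eq_iff)
    ultimately have "card (snd ` ?c ` L) = b + 1" by (simp add: card_image)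
    moreover have "snd ` ?c ` L \<subseteq> {y. (int b, y) \<in> C'}"
    proof
      fix y assume "y \<in> snd ` ?c ` L"
      then obtain p where p: "p \<in> ?c ` L" "y = snd p" by blast
      then have "p = (int b, y)" using col [OF p(1)] by (simp add: prod_eq_iff)
      moreover have "p \<in> C'" using p(1) by (auto simp: C'_def L_def)
      ultimately show "y \<in> {y. (int b, y) \<in> C'}" by simp
    qed
    moreover have "finite {y. (int b, y) \<in> C'}"
    proof (rule finite_subset)
      show "{y. (int b, y) \<in> C'} \<subseteq> snd ` C'" by force
      show "finite (snd ` C')" using finP by (simp add: C'_def)
    qed
    ultimately have "b + 1 \<le> card {y. (int b, y) \<in> C'}"
      using card_mono [of "{y. (int b, y) \<in> C'}" "snd ` ?c ` L"] by simp
    then have "b < card {y. (int b, y) \<in> C'}" by simp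
    then have "overfull a b C'" unfolding overfull_def by blast
    then show ?thesis using overfull_same_shape [OF push] by blast
  qed
qed

lemma trapped_fold_push:
  assumes n: "2 * int a < n" "2 * int b < n"
    and "finite S" and "S \<noteq> {}" and "confined a b n S \<or> overfull a b S"
  shows "confined a b n (fold push ds S) \<or> overfull a b (fold push ds S)"
  using assms(3-5)
proof (induction ds arbitrary: S)
  case (Cons d ds)
  \<comment> \<open>Stated for arbitrary \<open>a\<close> and \<open>b\<close>, because the diagonal
    reflection exchanges them; the four directions then reduce to the left push.\<close>
  define I where "I a b S \<longleftrightarrow> finite S \<and> S \<noteq> {} \<and> (confined a b n S \<or> overfull a b S)" for a b S
  have left: "I a b S \<Longrightarrow> I a b (push_left S)" if "2 * int a < n" "2 * int b < n" for a b S
    unfolding I_def using confined_push_left [of a b n S] overfull_push_left [of S a b] that by auto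
  have mirror: "I a b S \<Longrightarrow> I a b (mirror ` S)" if "2 * int b < n" for a b S
    unfolding I_def using that confined_mirror overfull_mirror by auto
  have swap: "I a b S \<Longrightarrow> I b a (prod.swap ` S)" for a b S
    unfolding I_def using confined_swap overfull_swap by auto
  have "I a b S" using Cons.prems by (simp add: I_def)
  then have "I a b (push d S)"
    by (cases d) (simp_all add: n left mirror swap)
  then show ?case using Cons.IH by (simp add: I_def)
qed simp

text \<open>The tokens of the first and the last column of \<open>P\<close> end up on the left and
  the right wall. These are still at least \<open>n - 1 - 2 * (b - 1)\<close> apart, too far for
  \<open>a\<close> columns.\<close>

lemma confined_not_box:
  assumes "confined a b n S" and n: "int a + 2 * int b < n + 2" and "0 < n"
  shows "\<not> is_box a b S"
proof
  assume box: "is_box a b S"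
  obtain P l r d u where P: "spread n (int a + int b) P"
    and lr: "0 \<le> l" "l < int b" "0 \<le> r" "r < int b" "0 \<le> d" "d < int a"
    and S: "S \<approx> clamp l (n - 1 - r) d (n - 1 - u) ` P"
    using assms(1) by (auto simp: confined_def)
  let ?c = "clamp l (n - 1 - r) d (n - 1 - u)"
  obtain x y where box': "?c ` P = {x..<x + int a} \<times> {y..<y + int b}"
    using is_box_same_shape [OF same_shape_sym [OF S] box] by (auto simp: is_box_def)
  have "0 \<in> fst ` P" "n - 1 \<in> fst ` P" using P \<open>0 < n\<close> by (auto simp: spread_def)
  then obtain p q where pq: "p \<in> P" "fst p = 0" "q \<in> P" "fst q = n - 1" by (metis imageE)
  have "?c p \<in> ?c ` P" "?c q \<in> ?c ` P" using pq by simp_all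
  then have "x \<le> fst (?c p)" "fst (?c q) < x + int a" unfolding box' by auto
  moreover have "l \<le> n - 1 - r" using lr n by linarith
  then have "fst (?c p) = l" "fst (?c q) = n - 1 - r"
    using pq lr by (auto simp: clamp_def case_prod_unfold)
  ultimately show False using lr n by linarith
qed


section \<open>The diamond\<close>

text \<open>The points of the diamond run alternately along its upper and its lower sides, starting from
  its left and right vertices.\<close>

definition diamond_row :: "int \<Rightarrow> int \<Rightarrow> int" where
  "diamond_row n x = (let h = n div 2 in
     if x < h then (if even x then n - h + x else h - 1 - x)
     else if n - 1 - x < h then (if even (n - 1 - x) then x + h - n else 2 * n - 1 - h - x)
     else h)"

definition diamond :: "int \<Rightarrow> cell set" where
  "diamond n = (\<lambda>x. (x, diamond_row n x)) ` {0..<n}"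

text \<open>The four sides and, for odd \<open>n\<close> only, the centre.\<close>

lemma diamond_row_cases:
  assumes "y = diamond_row n x" and "h = n div 2"
  obtains "x < h" "even x" "y = n - h + x"
  | "x < h" "odd x" "y = h - 1 - x"
  | "n - 1 - x < h" "even (n - 1 - x)" "y = x + h - n"
  | "n - 1 - x < h" "odd (n - 1 - x)" "y = 2 * n - 1 - h - x"
  | "h \<le> x" "h \<le> n - 1 - x" "y = h"
proof -
  have *: "y = (if x < h then (if even x then n - h + x else h - 1 - x)
     else if n - 1 - x < h then (if even (n - 1 - x) then x + h - n else 2 * n - 1 - h - x)
     else h)"
    unfolding assms diamond_row_def Let_def ..
  show thesis
  proof (cases "x < h")
    case True
    then show thesis using * that(1,2) by (cases "even x") simp_all
  next
    case False
    note x = this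
    show thesis
    proof (cases "n - 1 - x < h")
      case True
      then show thesis using x * that(3,4) by (cases "even (n - 1 - x)") simp_all
    next
      case False
      then show thesis using x * that(5) by simp
    qed
  qed
qed

text \<open>A token close to a corner in both coordinates lies on the side that cuts this corner
  off. Because the sides alternate, its column then has a fixed parity.\<close>

lemma diamond_sides:
  assumes "(x, y) \<in> diamond n" and h: "h = n div 2"
  shows "0 \<le> x" "x < n" "0 \<le> y" "y < n"
    and "h \<le> x \<or> h \<le> y \<or> x + y = h - 1 \<and> odd x"
    and "h \<le> n - 1 - x \<or> h \<le> y \<or> n - 1 - x + y = h - 1 \<and> even (n - 1 - x)"
    and "h \<le> x \<or> h \<le> n - 1 - y \<or> x + (n - 1 - y) = h - 1 \<and> even x"
    and "h \<le> n - 1 - x \<or> h \<le> n - 1 - y \<or> n - 1 - x + (n - 1 - y) = h - 1 \<and> odd (n - 1 - x)"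
proof -
  have n: "n = 2 * h \<or> n = 2 * h + 1" unfolding h by presburger
  have x: "0 \<le> x" "x < n" and y: "y = diamond_row n x"
    using assms(1) by (auto simp: diamond_def)
  note cases = diamond_row_cases [OF y h]
  show "0 \<le> x" "x < n" by (rule x)+
  show "0 \<le> y" "y < n" using x n by (cases rule: cases; linarith)+
  show "h \<le> x \<or> h \<le> y \<or> x + y = h - 1 \<and> odd x"
    "h \<le> n - 1 - x \<or> h \<le> y \<or> n - 1 - x + y = h - 1 \<and> even (n - 1 - x)"
    "h \<le> x \<or> h \<le> n - 1 - y \<or> x + (n - 1 - y) = h - 1 \<and> even x"
    "h \<le> n - 1 - x \<or> h \<le> n - 1 - y \<or> n - 1 - x + (n - 1 - y) = h - 1 \<and> odd (n - 1 - x)"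
    using x n by (cases rule: cases; presburger)+
qed

text \<open>Two tokens on the cutting side have columns of equal parity, so they differ by at least
  2 and the maxima add up to at least \<open>h - 1 + 2\<close>. If one token is off this side, one
  maximum is at least \<open>h\<close> and the other at least 1.\<close>

lemma corner_distance:
  fixes x y x' y' h :: int
  assumes "0 \<le> x" "0 \<le> y" "0 \<le> x'" "0 \<le> y'" "x \<noteq> x'" "y \<noteq> y'"
    and "h \<le> x \<or> h \<le> y \<or> x + y = h - 1 \<and> even (x + c)"
    and "h \<le> x' \<or> h \<le> y' \<or> x' + y' = h - 1 \<and> even (x' + c)"
  shows "h + 1 \<le> max x x' + max y y'"
proof -
  have "1 \<le> max x x'" "1 \<le> max y y'" using assms(1-6) by linarith+
  moreover have "x + 2 \<le> x' \<or> x' + 2 \<le> x" if "even (x + c)" "even (x' + c)"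
    using that assms(5) by presburger
  ultimately show ?thesis using assms(7,8) by linarith
qed

text \<open>Row \<open>n - h + j\<close> is used in the left half for even \<open>j\<close> and in
  the right half for odd \<open>j\<close>, where \<open>j\<close> is the distance from the left or
  right border; for row \<open>h - 1 - j\<close> it is the other way round.\<close>

lemma inj_diamond_row: "inj_on (diamond_row n) {0..<n}"
proof (rule inj_onI)
  fix x x' assume x: "x \<in> {0..<n}" "x' \<in> {0..<n}" "diamond_row n x = diamond_row n x'"
  define h where "h = n div 2"
  have n: "n = 2 * h \<or> n = 2 * h + 1" unfolding h_def by presburger
  show "x = x'"
    using x(1,2) n
    by (cases rule: diamond_row_cases [OF refl h_def, of x];
        cases rule: diamond_row_cases [OF x(3) h_def]; simp; presburger)
qed

lemma spread_diamond:
  assumes "s \<le> n div 2 + 1"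
  shows "spread n s (diamond n)"
proof (rule spreadI)
  note sides = diamond_sides [OF _ refl]
  show "inj_on fst (diamond n)" unfolding diamond_def by (auto simp: inj_on_def)
  show inj: "inj_on snd (diamond n)"
    unfolding diamond_def using inj_diamond_row [of n] by (auto simp: inj_on_def)
  show fst: "fst ` diamond n = {0..<n}" unfolding diamond_def by (simp add: image_image)
  have "diamond_row n ` {0..<n} \<subseteq> {0..<n}"
  proof clarify
    fix x assume "x \<in> {0..<n}"
    then have "(x, diamond_row n x) \<in> diamond n" by (simp add: diamond_def)
    then show "diamond_row n x \<in> {0..<n}" using sides(3,4) by simp
  qed
  \<comment> \<open>An injective map of a finite set into itself is surjective.\<close>
  then have "diamond_row n ` {0..<n} = {0..<n}"
    using inj_diamond_row by (intro endo_inj_surj) auto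
  then show "snd ` diamond n = {0..<n}" unfolding diamond_def by (simp add: image_image)
  fix x y x' y'
  assume p: "(x, y) \<in> diamond n" and q: "(x', y') \<in> diamond n" and ne: "(x, y) \<noteq> (x', y')"
  have x: "x \<noteq> x'" using p q ne by (auto simp: diamond_def)
  have y: "y \<noteq> y'" using inj_onD [OF inj, of "(x, y)" "(x', y')"] p q ne by auto
  let ?r = "\<lambda>z. n - 1 - z"
  have r: "0 \<le> ?r x" "0 \<le> ?r x'" "0 \<le> ?r y" "0 \<le> ?r y'" "?r x \<noteq> ?r x'" "?r y \<noteq> ?r y'"
    using sides(2,4) [OF p] sides(2,4) [OF q] x y by simp_all
  note pos = sides(1,3) [OF p] sides(1,3) [OF q]
  \<comment> \<open>\<open>c\<close> encodes the parity of the columns, counted from the corner, on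
    the side near it: odd at the lower left and upper right corners, even at the other two.\<close>
  have "n div 2 + 1 \<le> max x x' + max y y'"
    by (rule corner_distance [where c = 1]) (use pos x y sides(5) [OF p] sides(5) [OF q] in auto)
  moreover have "n div 2 + 1 \<le> max (?r x) (?r x') + max y y'"
    by (rule corner_distance [where c = 0]) (use pos r y sides(6) [OF p] sides(6) [OF q] in auto)
  moreover have "n div 2 + 1 \<le> max x x' + max (?r y) (?r y')"
    by (rule corner_distance [where c = 0]) (use pos r x sides(7) [OF p] sides(7) [OF q] in auto)
  moreover have "n div 2 + 1 \<le> max (?r x) (?r x') + max (?r y) (?r y')"
    by (rule corner_distance [where c = 1]) (use r sides(8) [OF p] sides(8) [OF q] in auto)
  ultimately show "s \<le> max x x' + max y y' \<and> s \<le> max (?r x) (?r x') + max y y' \<and>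
      s \<le> max x x' + max (?r y) (?r y') \<and> s \<le> max (?r x) (?r x') + max (?r y) (?r y')"
    using assms by linarith
qed

lemma spread_sparse: "spread n s P \<Longrightarrow> sparse P"
  by (auto simp: spread_def sparse_def inj_on_def)

section \<open>Boxes out of reach of the diamond\<close>

lemma diamond_not_makes_box:
  assumes "3 \<le> a" and "3 \<le> b" and "\<not> (a = 3 \<and> b = 3)"
  shows "\<not> makes_box a b (diamond (int (a * b)))"
proof
  define n where "n = int (a * b)"
  assume "makes_box a b (diamond (int (a * b)))"
  then obtain ds where box: "is_box a b (fold push ds (diamond n))"
    unfolding makes_box_def n_def by blast
  \<comment> \<open>Expanded, this is \<open>2 * a + 2 * b - 2 \<le> n\<close>, so the corner
    distance \<open>n div 2 + 1\<close> of the diamond is at least \<open>a + b\<close>. For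
    \<open>a = b = 3\<close> the inequality fails by one.\<close>
  have "2 \<le> (int a - 2) * (int b - 2)"
  proof -
    consider "3 \<le> a" "4 \<le> b" | "4 \<le> a" "3 \<le> b" using assms by linarith
    then show ?thesis
    proof cases
      case 1
      then show ?thesis using mult_mono [of 1 "int a - 2" 2 "int b - 2"] by simp
    next
      case 2
      then show ?thesis using mult_mono [of 2 "int a - 2" 1 "int b - 2"] by simp
    qed
  qed
  then have "2 * int a + 2 * int b - 2 \<le> n" by (simp add: n_def algebra_simps)
  then have s: "int a + int b \<le> n div 2 + 1" and n: "2 * int a < n" "2 * int b < n"
    "int a + 2 * int b < n + 2" "0 < n"
    using assms by linarith+
  have spread: "spread n (int a + int b) (diamond n)" by (rule spread_diamond) (rule s)
  \<comment> \<open>At the start all four walls are on the border of the square, where clamping is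
    the identity.\<close>
  have "clamp 0 (n - 1 - 0) 0 (n - 1 - 0) ` diamond n = (\<lambda>p. p) ` diamond n"
    using diamond_sides(1-4) [OF _ refl] by (intro image_cong) (force simp: clamp_def)+
  then have "confined a b n (diamond n)"
    unfolding confined_def using spread assms
    by (intro exI [of _ "diamond n"] exI [of _ 0]) simp
  moreover have "finite (diamond n)" "diamond n \<noteq> {}" using n by (simp_all add: diamond_def)
  ultimately have "confined a b n (fold push ds (diamond n)) \<or> overfull a b (fold push ds (diamond n))"
    using trapped_fold_push [OF n(1,2)] by blast
  then show False using box box_not_overfull confined_not_box n(3,4) by blast
qed

section \<open>The equivalence\<close>

theorem theorem1:
  fixes a b n :: nat
  assumes "a > 0" and "b > 0" and "n = a * b"
  shows "(\<forall>S :: cell set. finite S \<and> card S = n \<and> sparse S \<longrightarrow>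
            (\<exists>ds :: direction list. is_box a b (fold push ds S)))
         \<longleftrightarrow> a \<le> 2 \<or> b \<le> 2 \<or> (a = 3 \<and> b = 3)"
proof (fold makes_box_def, intro iffI allI impI)
  assume all: "\<forall>S. finite S \<and> card S = n \<and> sparse S \<longrightarrow> makes_box a b S"
  show "a \<le> 2 \<or> b \<le> 2 \<or> (a = 3 \<and> b = 3)"
  proof (rule ccontr)
    assume "\<not> ?thesis"
    then have "\<not> makes_box a b (diamond (int n))"
      using diamond_not_makes_box assms(3) by simp
    moreover have "finite (diamond (int n))" "card (diamond (int n)) = n"
      unfolding diamond_def by (simp_all add: card_image inj_on_def)
    moreover have "sparse (diamond (int n))" by (rule spread_sparse [OF spread_diamond [OF order_refl]])
    ultimately show False using all by blast
  qed
next
  \<comment> \<open>Generalised over \<open>a\<close>, \<open>b\<close> and \<open>S\<close>, so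
    that the case \<open>b \<le> 2\<close> can use it after the diagonal reflection.\<close>
  have narrow: "makes_box a b S"
    if S: "a \<le> 2" "a > 0" "b > 0" "finite S" "card S = a * b" "sparse S" for a b S
  proof -
    consider "a = 1" | "a = 2" using S(1,2) by linarith
    then show ?thesis using makes_box_1 [of S b] makes_box_2 [of S b] S by cases simp_all
  qed
  fix S assume "a \<le> 2 \<or> b \<le> 2 \<or> (a = 3 \<and> b = 3)" and S: "finite S \<and> card S = n \<and> sparse S"
  then consider "a \<le> 2" | "b \<le> 2" | "a = 3" "b = 3" by blast
  then show "makes_box a b S"
  proof cases
    case 1
    then show ?thesis using narrow S assms by simp
  next
    case 2
    have "makes_box b a (prod.swap ` S)"
      using S assms 2 by (intro narrow) (simp_all add: card_image sparse_swap mult.commute)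
    then show ?thesis using makes_box_swap by fastforce
  next
    case 3
    then show ?thesis using makes_box_3 S assms by simp
  qed
qed

end
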